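(* There exists an infinite sequence $(\Gamma_n)_{n=1}^\infty$ of CNF formulas such that $\Gamma_n$ admits $\mathsf{SBC}^-$ proofs of size $n^{O(1)}$ but requires $\mathsf{GER}^-$ proofs of size $2^{\Omega(n)}$.
   Context: A literal is a propositional variable or its negation; $\overline{p}$ is the complement of $p$, and $\overline{L}=\{\overline{p} : p\in L\}$ for a set $L$ of literals. A set of literals is tautological if it contains some $x$ and $\overline{x}$. A clause is a finite nontautological set of literals (read as a disjunction); $\bot$ is the empty clause. A CNF is a finite set of clauses; $\mathrm{var}(\Gamma)$ is the set of variables occurring in $\Gamma$. "Proof" of $\Gamma$ means refutation. Resolution. If $A\cup\{x\}$ and $B\cup\{\overline{x}\}$ are clauses with $x$ a variable not occurring in $A$ or $B$, and $A\cup B$ is a clause, then $A\cup B$ is their resolvent on $x$. A weakening of a clause $A$ is any clause $A\cup B$. A resolution proof of $\Gamma$ is a sequence $\Pi=(\Gamma_1,\dots,\Gamma_N)$ of CNFs with $\Gamma_1=\Gamma$, $\bot\in\Gamma_N$, and each $\Gamma_{i+1}=\Gamma_i\cup\{C\}$, where $C$ is a resolvent of two clauses of $\Gamma_i$ or a weakening of a clause of $\Gamma_i$. Its size is $|\Pi|=N$. SBC. A clause $C$ is a set-blocked clause (SBC) for a nonempty $L\subseteq C$ with respect to $\Gamma$ if for every $D\in\Gamma$ with $D\cap\overline{L}\neq\varnothing$ and $D\cap L=\varnothing$ the set $(C\setminus L)\cup(D\setminus\overline{L})$ is tautological. $C$ is an SBC with respect to $\Gamma$ if it is one for some nonempty $L\subseteq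 C$. An $\mathsf{SBC}$ proof of $\Gamma$ is defined like a resolution proof, except that each added clause $C$ may also be any SBC with respect to the current CNF $\Gamma_i$; its size is $N$. An $\mathsf{SBC}^-$ proof of $\Gamma$ is an $\mathsf{SBC}$ proof in which only variables of $\mathrm{var}(\Gamma)$ occur. GER. A clause $C=\{p\}\cup C'$ (variable of $p$ not in $C'$) is blocked for $p$ with respect to $\Gamma$ if for every $D\in\Gamma$ of the form $\{\overline{p}\}\cup D'$ (variable of $p$ not in $D'$) the set $C'\cup D'$ is tautological; $C$ is blocked with respect to $\Gamma$ if it is so for some $p\in C$. The kernel $\ker(\Gamma)$ is the CNF obtained from $\Gamma$ by repeatedly removing a clause that is blocked with respect to the current set, until no clause of the current set is blocked with respect to it (the result does not depend on the order of removal). A CNF $\Lambda$ is a blocked extension for $\Gamma$ if $\ker(\Gamma\cup\Lambda)=\ker(\Gamma)$. A $\mathsf{GER}$ proof of $\Gamma$ is a pair $(\Lambda,\Pi)$ where $\Lambda$ is a blocked extension for $\Gamma$ and $\Pi$ is a resolution proof of $\Gamma\cup\Lambda$; its size is $|\Lambda|+|\Pi|$, where $|\Lambda|$ is the number of clauses. It is a $\mathsf{GER}^-$ proof if $\mathrm{var}(\Lambda)\subseteq\mathrm{var}(\Gamma)$. *)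

theory Defs
  imports Complex_Main "HOL-Library.Landau_Symbols"
begin

datatype 'v literal = Pos (var_of: 'v) | Neg (var_of: 'v)

fun compl :: "'v literal \<Rightarrow> 'v literal" where
  "compl (Pos x) = Neg x"
| "compl (Neg x) = Pos x"

type_synonym 'v clause = "'v literal set"
type_synonym 'v cnf = "'v clause set"

definition tautological :: "'v literal set \<Rightarrow> bool" where
  "tautological L \<longleftrightarrow> (\<exists>x. Pos x \<in> L \<and> Neg x \<in> L)"

definition is_clause :: "'v clause \<Rightarrow> bool" where
  "is_clause C \<longleftrightarrow> finite C \<and> \<not> tautological C"

definition is_cnf :: "'v cnf \<Rightarrow> bool" where
  "is_cnf \<Gamma> \<longleftrightarrow> finite \<Gamma> \<and> (\<forall>C\<in>\<Gamma>. is_clause C)"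

definition vars_clause :: "'v clause \<Rightarrow> 'v set" where
  "vars_clause C = var_of ` C"

definition vars :: "'v cnf \<Rightarrow> 'v set" where
  "vars \<Gamma> = (\<Union>C\<in>\<Gamma>. vars_clause C)"

definition is_resolvent :: "'v clause \<Rightarrow> 'v clause \<Rightarrow> 'v clause \<Rightarrow> bool" where
  "is_resolvent P Q C \<longleftrightarrow>
    (\<exists>x A B. P = A \<union> {Pos x} \<and> Q = B \<union> {Neg x} \<and> C = A \<union> B \<and>
       x \<notin> vars_clause A \<and> x \<notin> vars_clause B \<and>
       is_clause P \<and> is_clause Q \<and> is_clause C)"

definition is_weakening :: "'v clause \<Rightarrow> 'v clause \<Rightarrow> bool" where
  "is_weakening A C \<longleftrightarrow> is_clause C \<and> (\<exists>B. C = A \<union> B)"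

definition res_rule :: "'v cnf \<Rightarrow> 'v clause \<Rightarrow> bool" where
  "res_rule \<Gamma> C \<longleftrightarrow>
    (\<exists>P\<in>\<Gamma>. \<exists>Q\<in>\<Gamma>. is_resolvent P Q C) \<or> (\<exists>A\<in>\<Gamma>. is_weakening A C)"

definition set_blocked_for :: "'v literal set \<Rightarrow> 'v cnf \<Rightarrow> 'v clause \<Rightarrow> bool" where
  "set_blocked_for L \<Gamma> C \<longleftrightarrow> L \<noteq> {} \<and> L \<subseteq> C \<and>
    (\<forall>D\<in>\<Gamma>. D \<inter> compl ` L \<noteq> {} \<and> D \<inter> L = {} \<longrightarrow>
       tautological ((C - L) \<union> (D - compl ` L)))"

definition set_blocked :: "'v cnf \<Rightarrow> 'v clause \<Rightarrow> bool" where
  "set_blocked \<Gamma> C \<longleftrightarrow> is_clause C \<and> (\<exists>L. set_blocked_for L \<Gamma> C)"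

definition sbc_rule :: "'v cnf \<Rightarrow> 'v clause \<Rightarrow> bool" where
  "sbc_rule \<Gamma> C \<longleftrightarrow> res_rule \<Gamma> C \<or> set_blocked \<Gamma> C"

text \<open>Proofs are refutations, given as the list of successive CNFs. The size of such a proof is
  the length of this list.\<close>

definition is_proof ::
  "('v cnf \<Rightarrow> 'v clause \<Rightarrow> bool) \<Rightarrow> 'v cnf \<Rightarrow> 'v cnf list \<Rightarrow> bool" where
  "is_proof rule \<Gamma> \<Pi> \<longleftrightarrow>
    \<Pi> \<noteq> [] \<and> (\<forall>\<Delta>\<in>set \<Pi>. is_cnf \<Delta>) \<and> hd \<Pi> = \<Gamma> \<and> {} \<in> last \<Pi> \<and>
    (\<forall>i. Suc i < length \<Pi> \<longrightarrow> (\<exists>C. rule (\<Pi> ! i) C \<and> \<Pi> ! Suc i = \<Pi> ! i \<union> {C}))"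

definition resolution_proof :: "'v cnf \<Rightarrow> 'v cnf list \<Rightarrow> bool" where
  "resolution_proof = is_proof res_rule"

definition SBC_proof :: "'v cnf \<Rightarrow> 'v cnf list \<Rightarrow> bool" where
  "SBC_proof = is_proof sbc_rule"

definition SBC_minus_proof :: "'v cnf \<Rightarrow> 'v cnf list \<Rightarrow> bool" where
  "SBC_minus_proof \<Gamma> \<Pi> \<longleftrightarrow> SBC_proof \<Gamma> \<Pi> \<and> (\<forall>\<Delta>\<in>set \<Pi>. vars \<Delta> \<subseteq> vars \<Gamma>)"

definition blocked_for :: "'v literal \<Rightarrow> 'v cnf \<Rightarrow> 'v clause \<Rightarrow> bool" where
  "blocked_for p \<Gamma> C \<longleftrightarrow>
    (\<exists>C'. C = {p} \<union> C' \<and> var_of p \<notin> vars_clause C' \<and>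
       (\<forall>D'. {compl p} \<union> D' \<in> \<Gamma> \<and> var_of p \<notin> vars_clause D' \<longrightarrow> tautological (C' \<union> D')))"

definition blocked :: "'v cnf \<Rightarrow> 'v clause \<Rightarrow> bool" where
  "blocked \<Gamma> C \<longleftrightarrow> (\<exists>p\<in>C. blocked_for p \<Gamma> C)"

definition remove_blocked :: "'v cnf \<Rightarrow> 'v cnf \<Rightarrow> bool" where
  "remove_blocked \<Gamma> \<Gamma>' \<longleftrightarrow> (\<exists>C\<in>\<Gamma>. blocked \<Gamma> C \<and> \<Gamma>' = \<Gamma> - {C})"

definition is_kernel :: "'v cnf \<Rightarrow> 'v cnf \<Rightarrow> bool" where
  "is_kernel \<Gamma> \<Delta> \<longleftrightarrow> remove_blocked\<^sup>*\<^sup>* \<Gamma> \<Delta> \<and> \<not> (\<exists>C\<in>\<Delta>. blocked \<Delta> C)"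

text \<open>Well-defined on CNFs by lemma \<open>ex1_is_kernel\<close> below.\<close>

definition ker :: "'v cnf \<Rightarrow> 'v cnf" where
  "ker \<Gamma> = (THE \<Delta>. is_kernel \<Gamma> \<Delta>)"

lemma blocked_antimono: "blocked \<Gamma> C \<Longrightarrow> \<Delta> \<subseteq> \<Gamma> \<Longrightarrow> blocked \<Delta> C"
  unfolding blocked_def blocked_for_def by blast

lemma remove_blocked_subset: "remove_blocked\<^sup>*\<^sup>* \<Gamma> \<Delta> \<Longrightarrow> \<Delta> \<subseteq> \<Gamma>"
  by (induction rule: rtranclp_induct) (auto simp: remove_blocked_def)

lemma irreducible_subset:
  assumes "remove_blocked\<^sup>*\<^sup>* \<Gamma> \<Delta>" "\<Theta> \<subseteq> \<Gamma>" "\<not> (\<exists>C\<in>\<Theta>. blocked \<Theta> C)"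
  shows "\<Theta> \<subseteq> \<Delta>"
  using assms
proof (induction rule: rtranclp_induct)
  case (step \<Delta>1 \<Delta>2)
  then show ?case
    using blocked_antimono unfolding remove_blocked_def by blast
qed

lemma ex_is_kernel: "finite \<Gamma> \<Longrightarrow> \<exists>\<Delta>. is_kernel \<Gamma> \<Delta>"
proof (induction \<Gamma> rule: finite_psubset_induct)
  case (psubset \<Gamma>)
  show ?case
  proof (cases "\<exists>C\<in>\<Gamma>. blocked \<Gamma> C")
    case True
    then obtain C where C: "C \<in> \<Gamma>" "blocked \<Gamma> C" by blast
    then have "remove_blocked \<Gamma> (\<Gamma> - {C})" by (auto simp: remove_blocked_def)
    moreover obtain \<Delta> where "is_kernel (\<Gamma> - {C}) \<Delta>" using psubset.IH C by blast
    ultimately have "is_kernel \<Gamma> \<Delta>"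
      unfolding is_kernel_def by (auto intro: converse_rtranclp_into_rtranclp)
    then show ?thesis ..
  next
    case False
    then show ?thesis by (auto simp: is_kernel_def)
  qed
qed

lemma ex1_is_kernel:
  assumes "is_cnf \<Gamma>"
  shows "\<exists>!\<Delta>. is_kernel \<Gamma> \<Delta>"
proof (rule ex_ex1I)
  show "\<exists>\<Delta>. is_kernel \<Gamma> \<Delta>" using assms ex_is_kernel by (auto simp: is_cnf_def)
next
  fix \<Delta> \<Theta>
  assume "is_kernel \<Gamma> \<Delta>" "is_kernel \<Gamma> \<Theta>"
  then show "\<Delta> = \<Theta>"
    unfolding is_kernel_def by (meson irreducible_subset remove_blocked_subset subset_antisym)
qed

lemma is_kernel_ker: "is_cnf \<Gamma> \<Longrightarrow> is_kernel \<Gamma> (ker \<Gamma>)"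
  unfolding ker_def by (rule theI') (rule ex1_is_kernel)

definition blocked_extension :: "'v cnf \<Rightarrow> 'v cnf \<Rightarrow> bool" where
  "blocked_extension \<Gamma> \<Lambda> \<longleftrightarrow> is_cnf \<Lambda> \<and> ker (\<Gamma> \<union> \<Lambda>) = ker \<Gamma>"

definition GER_proof :: "'v cnf \<Rightarrow> 'v cnf \<times> 'v cnf list \<Rightarrow> bool" where
  "GER_proof \<Gamma> = (\<lambda>(\<Lambda>, \<Pi>). blocked_extension \<Gamma> \<Lambda> \<and> resolution_proof (\<Gamma> \<union> \<Lambda>) \<Pi>)"

definition GER_size :: "'v cnf \<times> 'v cnf list \<Rightarrow> nat" where
  "GER_size = (\<lambda>(\<Lambda>, \<Pi>). card \<Lambda> + length \<Pi>)"

text \<open>Only the extension is restricted to the variables of \<open>\<Gamma>\<close>; weakening steps in the resolution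
  part may still introduce other variables.\<close>

definition GER_minus_proof :: "'v cnf \<Rightarrow> 'v cnf \<times> 'v cnf list \<Rightarrow> bool" where
  "GER_minus_proof \<Gamma> P \<longleftrightarrow> GER_proof \<Gamma> P \<and> vars (fst P) \<subseteq> vars \<Gamma>"

end

(*  The formula is the pigeonhole principle with two additions. All weakenings of its clauses by one
    literal are included: since the pigeonhole clauses are unsatisfiable, this prevents any clause
    from being blocked for a literal of the original variables. Each variable x0 that Cook's short
    extended resolution refutation introduces is tripled to x0, x1, x2, and the implications
    x0 -> x1 -> x2 -> x0 are added. A clause is blocked for a literal of such a triple only if it
    contains two adjacent variables of the cycle, the earlier one positively and the later one
    negatively. So the formula is its own kernel, and every new clause of a blocked extension is
    satisfied by setting all triples to true. What remains is the pigeonhole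
    principle, for which the counting argument of Beame and Pitassi over critical assignments gives
    an exponential resolution lower bound. Set-blocked clauses, on the other hand, may set a whole
    triple at once to either constant, hence can define x0 = x1 = x2 to be any function of other
    variables, and this simulates Cook's refutation. *)

theory Submission
  imports Defs "HOL-Library.Nat_Bijection"
begin

section \<open>Chains of inference steps\<close>

text \<open>Three is the least length for which the cycle survives in the kernel. With two
  variables, \<open>{~x0, x1}\<close> and \<open>{~x1, x0}\<close> resolve only to tautologies, so
  each would be blocked by the other and the guard would vanish. With three, the successor of the
  positive variable of an implication is not its negative variable. The formula has to be its own
  kernel because blockedness survives the removal of clauses: each new clause of a blocked extension
  is then blocked with respect to the formula alone, whatever the other new clauses and the order of
  removal. Membership in an extension becomes a condition on single clauses. Cook's variables must
  occur in the formula from the start, since \<open>SBC_minus_proof\<close> forbids new ones.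
  Constants of the lower bound: a middle clause is falsified for between a third and two thirds of
  the p free pigeons, so it has at least 2 p^2 / 9 entries, hence n^2 / 18 while p >= n / 2. The
  free grid has at most 2 n^2 entries, so some entry hits a 36th of such clauses, and n div 2 greedy
  choices shrink their number by the factor (35/36)^(n div 2).\<close>

inductive reach :: "('v cnf \<Rightarrow> 'v clause \<Rightarrow> bool) \<Rightarrow> 'v set \<Rightarrow> nat \<Rightarrow> 'v cnf \<Rightarrow> 'v cnf \<Rightarrow> bool"
  for rule V where
  reach_refl: "reach rule V 0 \<Gamma> \<Gamma>"
| reach_step: "reach rule V k \<Gamma> \<Delta> \<Longrightarrow> rule \<Delta> C \<Longrightarrow> vars_clause C \<subseteq> V \<Longrightarrow>
    reach rule V (Suc k) \<Gamma> (insert C \<Delta>)"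

lemma reach_trans:
  assumes "reach rule V l \<Delta> \<Theta>" "reach rule V k \<Gamma> \<Delta>"
  shows "reach rule V (k + l) \<Gamma> \<Theta>"
  using assms by induction (auto intro: reach_step)

lemma reach_rule_mono:
  assumes "reach rule V k \<Gamma> \<Delta>" "\<And>\<Gamma> C. rule \<Gamma> C \<Longrightarrow> rule' \<Gamma> C"
  shows "reach rule' V k \<Gamma> \<Delta>"
  using assms by induction (auto intro: reach.intros)

lemma reach_imp_proof:
  assumes "reach rule V k \<Gamma> \<Delta>" "\<forall>\<Gamma> C. rule \<Gamma> C \<longrightarrow> is_clause C"
    and "is_cnf \<Gamma>" "vars \<Gamma> \<subseteq> V"
  shows "\<exists>\<Pi>. \<Pi> \<noteq> [] \<and> (\<forall>\<Theta>\<in>set \<Pi>. is_cnf \<Theta> \<and> vars \<Theta> \<subseteq> V) \<and> hd \<Pi> = \<Gamma> \<and> last \<Pi> = \<Delta> \<and>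
    (\<forall>i. Suc i < length \<Pi> \<longrightarrow> (\<exists>C. rule (\<Pi> ! i) C \<and> \<Pi> ! Suc i = \<Pi> ! i \<union> {C})) \<and>
    length \<Pi> = Suc k"
  using assms
proof induction
  case (reach_refl \<Gamma>)
  then show ?case by (intro exI[of _ "[\<Gamma>]"]) auto
next
  case (reach_step k \<Gamma> \<Delta> C)
  then obtain \<Pi> where \<Pi>: "\<Pi> \<noteq> []" "\<forall>\<Theta>\<in>set \<Pi>. is_cnf \<Theta> \<and> vars \<Theta> \<subseteq> V" "hd \<Pi> = \<Gamma>"
    "last \<Pi> = \<Delta>" "\<forall>i. Suc i < length \<Pi> \<longrightarrow> (\<exists>C. rule (\<Pi> ! i) C \<and> \<Pi> ! Suc i = \<Pi> ! i \<union> {C})"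
    "length \<Pi> = Suc k"
    by blast
  let ?\<Pi> = "\<Pi> @ [insert C \<Delta>]"
  have k: "\<Pi> ! k = \<Delta>" using \<Pi> by (metis diff_Suc_1 last_conv_nth)
  have "is_cnf \<Delta>" "vars \<Delta> \<subseteq> V" using \<Pi> last_in_set by blast+
  then have "is_cnf (insert C \<Delta>)" "vars (insert C \<Delta>) \<subseteq> V"
    using reach_step by (auto simp: is_cnf_def vars_def)
  moreover have "\<exists>C. rule (?\<Pi> ! i) C \<and> ?\<Pi> ! Suc i = ?\<Pi> ! i \<union> {C}" if "Suc i < length ?\<Pi>" for i
  proof (cases "Suc i < length \<Pi>")
    case True
    then show ?thesis using \<Pi> by (auto simp: nth_append)
  next
    case False
    then have "i = k" using that \<Pi> by auto
    then show ?thesis using k \<Pi> reach_step.hyps by (auto simp: nth_append)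
  qed
  ultimately show ?case using \<Pi> by (intro exI[of _ ?\<Pi>]) auto
qed

lemma reach_imp_is_proof:
  assumes "reach rule V k \<Gamma> \<Delta>" "\<forall>\<Gamma> C. rule \<Gamma> C \<longrightarrow> is_clause C"
    and "is_cnf \<Gamma>" "vars \<Gamma> \<subseteq> V" "{} \<in> \<Delta>"
  obtains \<Pi> where "is_proof rule \<Gamma> \<Pi>" "\<forall>\<Theta>\<in>set \<Pi>. vars \<Theta> \<subseteq> V" "length \<Pi> = Suc k"
  using reach_imp_proof[OF assms(1-4)] assms(5) that unfolding is_proof_def by metis

lemma res_rule_mono: "res_rule \<Gamma> C \<Longrightarrow> \<Gamma> \<subseteq> \<Gamma>' \<Longrightarrow> res_rule \<Gamma>' C"
  unfolding res_rule_def by blast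

text \<open>Resolution and weakening stay applicable in a larger CNF, and adding a clause that is
  already present still counts as a step. Set-blockedness is not monotone, which is why all
  definitions are introduced before the resolution part begins.\<close>

lemma reach_res_mono:
  assumes "reach res_rule V k \<Gamma> \<Delta>" "\<Gamma> \<subseteq> \<Gamma>'"
  shows "reach res_rule V k \<Gamma>' (\<Gamma>' \<union> \<Delta>)"
  using assms
proof induction
  case (reach_refl \<Gamma>)
  then show ?case by (simp add: reach.reach_refl Un_absorb2)
next
  case (reach_step k \<Gamma> \<Delta> C)
  then show ?case
    using reach.reach_step[of res_rule V k \<Gamma>' "\<Gamma>' \<union> \<Delta>" C] res_rule_mono[of \<Delta> C "\<Gamma>' \<union> \<Delta>"] by auto
qed

lemma reach_subset: "reach rule V k \<Gamma> \<Delta> \<Longrightarrow> \<Gamma> \<subseteq> \<Delta>"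
  by (induction rule: reach.induct) auto

text \<open>A bound instead of an exact length, and a subset instead of the whole final CNF, so that
  derivations combine while auxiliary clauses stay out of sight.\<close>

definition derives :: "'v set \<Rightarrow> nat \<Rightarrow> 'v cnf \<Rightarrow> 'v cnf \<Rightarrow> bool" where
  "derives V k \<Gamma> S \<longleftrightarrow> (\<exists>j\<le>k. \<exists>\<Delta>. reach res_rule V j \<Gamma> \<Delta> \<and> S \<subseteq> \<Delta>)"

lemma derives_mono:
  assumes "derives V k \<Gamma> S" "k \<le> k'" "\<Gamma> \<subseteq> \<Gamma>'" "S' \<subseteq> S"
  shows "derives V k' \<Gamma>' S'"
proof -
  obtain j \<Delta> where "j \<le> k" "reach res_rule V j \<Gamma> \<Delta>" "S \<subseteq> \<Delta>"
    using assms(1) unfolding derives_def by blast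
  then have "j \<le> k'" "reach res_rule V j \<Gamma>' (\<Gamma>' \<union> \<Delta>)" "S' \<subseteq> \<Gamma>' \<union> \<Delta>"
    using assms reach_res_mono by auto
  then show ?thesis unfolding derives_def by blast
qed

lemma derives_refl: "S \<subseteq> \<Gamma> \<Longrightarrow> derives V k \<Gamma> S"
  unfolding derives_def using reach_refl by blast

lemma derives_trans:
  assumes "derives V k \<Gamma> S" "derives V l (\<Gamma> \<union> S) T"
  shows "derives V (k + l) \<Gamma> (S \<union> T)"
proof -
  obtain i \<Delta> where 1: "i \<le> k" "reach res_rule V i \<Gamma> \<Delta>" "S \<subseteq> \<Delta>"
    using assms(1) unfolding derives_def by blast
  obtain j \<Theta> where 2: "j \<le> l" "reach res_rule V j (\<Gamma> \<union> S) \<Theta>" "T \<subseteq> \<Theta>"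
    using assms(2) unfolding derives_def by blast
  have "\<Gamma> \<union> S \<subseteq> \<Delta>" using 1 reach_subset by blast
  then have "reach res_rule V j \<Delta> (\<Delta> \<union> \<Theta>)" using 2 reach_res_mono by blast
  then have "reach res_rule V (i + j) \<Gamma> (\<Delta> \<union> \<Theta>)" using 1 reach_trans by blast
  then show ?thesis unfolding derives_def using 1 2
    by (intro exI[of _ "i + j"] conjI exI[of _ "\<Delta> \<union> \<Theta>"]) auto
qed

lemma derives_cut:
  assumes "derives V k \<Gamma> S" "derives V l (\<Gamma> \<union> S) T"
  shows "derives V (k + l) \<Gamma> T"
  using derives_mono[OF derives_trans[OF assms]] by auto

lemma derives_UN:
  assumes "finite I" "\<And>i. i \<in> I \<Longrightarrow> derives V k \<Gamma> (S i)"
  shows "derives V (card I * k) \<Gamma> (\<Union>i\<in>I. S i)"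
  using assms
proof (induction I)
  case empty
  then show ?case by (simp add: derives_refl)
next
  case (insert i I)
  have "derives V (k + card I * k) \<Gamma> (S i \<union> (\<Union>i\<in>I. S i))"
    using insert by (intro derives_trans) (auto intro: derives_mono[of V _ \<Gamma>])
  then show ?case using insert by simp
qed

lemma derives_resolvent:
  assumes "insert (Pos x) A \<in> \<Gamma>" "insert (Neg x) B \<in> \<Gamma>" "x \<notin> vars_clause A" "x \<notin> vars_clause B"
    and "C = A \<union> B" "is_clause C" "vars_clause C \<subseteq> V"
  shows "derives V 1 \<Gamma> {C}"
proof -
  have x: "Pos x \<notin> C" "Neg x \<notin> C"
    using assms(3-5) unfolding vars_clause_def by (metis Un_iff imageI literal.sel)+
  have "finite A" "finite B" "\<not> tautological C" using assms(5,6) by (auto simp: is_clause_def)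
  then have "is_clause (insert (Pos x) A)" "is_clause (insert (Neg x) B)"
    using x unfolding is_clause_def tautological_def assms(5) by auto
  then have "is_resolvent (insert (Pos x) A) (insert (Neg x) B) C"
    
    unfolding is_resolvent_def
    using assms(3-6) by (intro exI[of _ x] exI[of _ A] exI[of _ B]) simp
  then have "res_rule \<Gamma> C" unfolding res_rule_def using assms by blast
  then have "reach res_rule V (Suc 0) \<Gamma> (insert C \<Gamma>)" using assms by (intro reach.intros) auto
  then show ?thesis unfolding derives_def by (intro exI[of _ 1] conjI exI[of _ "insert C \<Gamma>"]) simp_all
qed

lemma derives_weakening:
  assumes "A \<in> \<Gamma>" "A \<subseteq> C" "is_clause C" "vars_clause C \<subseteq> V"
  shows "derives V 1 \<Gamma> {C}"
proof -
  have "res_rule \<Gamma> C" unfolding res_rule_def is_weakening_def using assms by blast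
  then have "reach res_rule V (Suc 0) \<Gamma> (insert C \<Gamma>)" using assms by (intro reach.intros) auto
  then show ?thesis unfolding derives_def by (intro exI[of _ 1] conjI exI[of _ "insert C \<Gamma>"]) simp_all
qed

text \<open>Carries a pigeon clause one level down, exchanging its literals one at a time;
  \<open>K t\<close> is the hybrid in which the first \<open>t\<close> are exchanged. The side
  literals \<open>B\<close> of the implications already lie in \<open>A\<close>, so they do not
  accumulate. The disjointness assumptions keep the hybrids nontautological and the resolved
  variable out of the rest.\<close>

lemma derives_replace:
  fixes f g :: "nat \<Rightarrow> 'v"
  assumes start: "A \<union> (\<lambda>j. Pos (f j)) ` {..<m} \<in> \<Gamma>"
    and imp: "\<And>j. j < m \<Longrightarrow> insert (Neg (f j)) (insert (Pos (g j)) B) \<in> \<Gamma>"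
    and BA: "B \<subseteq> A" and A: "finite A" "\<not> tautological A"
    and f: "inj_on f {..<m}" "f ` {..<m} \<inter> var_of ` A = {}"
    and g: "g ` {..<m} \<inter> var_of ` A = {}" "f ` {..<m} \<inter> g ` {..<m} = {}"
    and V: "f ` {..<m} \<subseteq> V" "g ` {..<m} \<subseteq> V" "var_of ` A \<subseteq> V"
  shows "derives V m \<Gamma> {A \<union> (\<lambda>j. Pos (g j)) ` {..<m}}"
proof -
  define K where "K t = A \<union> (\<lambda>j. Pos (g j)) ` {..<t} \<union> (\<lambda>j. Pos (f j)) ` {t..<m}" for t
  have "derives V t \<Gamma> {K t}" if "t \<le> m" for t
    using that
  proof (induction t)
    case 0
    then show ?case using start by (auto simp: K_def derives_refl lessThan_atLeast0)
  next
    case (Suc t)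
    define A' where "A' = A \<union> (\<lambda>j. Pos (g j)) ` {..<t} \<union> (\<lambda>j. Pos (f j)) ` {Suc t..<m}"
    have f_in: "f t \<in> f ` {..<m}" and g_in: "g ` {..<Suc t} \<subseteq> g ` {..<m}" "g t \<in> g ` {..<m}" "g ` {..<t} \<subseteq> g ` {..<m}"
      using Suc.prems by auto
    have fresh: "f t \<notin> g ` {..<m}" "f t \<notin> var_of ` A"
      using f(2) g(2) f_in by (metis disjoint_iff)+
    have split: "{t..<m} = insert t {Suc t..<m}" using Suc.prems by auto
    have K: "K t = insert (Pos (f t)) A'"
      using split by (simp add: K_def A'_def)
    have "f t \<notin> vars_clause A'"
    proof -
      have "f t \<notin> f ` {Suc t..<m}"
        using Suc.prems by (subst inj_on_image_mem_iff[OF f(1)]) auto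
      moreover have "f t \<notin> g ` {..<t}" "f t \<notin> var_of ` A"
        using fresh g_in by (metis subsetD, metis)
      ultimately show ?thesis by (simp add: A'_def vars_clause_def image_Un image_image)
    qed
    moreover have "f t \<notin> vars_clause (insert (Pos (g t)) B)"
    proof -
      have "f t \<noteq> g t" "f t \<notin> var_of ` B"
        using fresh g_in BA by (metis, metis image_mono subsetD)
      then show ?thesis by (simp add: vars_clause_def)
    qed
    moreover have "K (Suc t) = A' \<union> insert (Pos (g t)) B"
      using BA by (auto simp: A'_def K_def lessThan_Suc)
    moreover have "is_clause (K (Suc t))"
    proof -
      have "Neg x \<in> A" "Pos x \<in> A \<or> x \<in> f ` {..<m} \<or> x \<in> g ` {..<m}"
        if "Pos x \<in> K (Suc t)" "Neg x \<in> K (Suc t)" for x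
        using that Suc.prems by (auto simp: K_def)
      moreover have "x \<notin> f ` {..<m}" "x \<notin> g ` {..<m}" if "Neg x \<in> A" for x
        using that f(2) g(1) by (metis disjoint_iff imageI literal.sel(2))+
      ultimately have "\<not> tautological (K (Suc t))" using A(2) unfolding tautological_def by blast
      then show ?thesis using A(1) by (simp add: is_clause_def K_def)
    qed
    moreover have "vars_clause (K (Suc t)) \<subseteq> V"
    proof -
      have "f ` {Suc t..<m} \<subseteq> V" "g ` {..<Suc t} \<subseteq> V" using V Suc.prems by auto
      then show ?thesis using V(3) by (simp add: K_def vars_clause_def image_Un image_image)
    qed
    ultimately have "derives V 1 (\<Gamma> \<union> {K t}) {K (Suc t)}"
      using imp[of t] K Suc.prems
      by (intro derives_resolvent[of "f t" A' _ "insert (Pos (g t)) B"]) simp_all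
    from derives_cut[OF Suc.IH this] Suc.prems show ?case by simp
  qed
  from this[of m] show ?thesis by (simp add: K_def)
qed

section \<open>The formula and its extension clauses\<close>

definition var :: "nat \<Rightarrow> nat \<Rightarrow> nat \<Rightarrow> nat \<Rightarrow> nat" where
  "var t m i j = prod_encode (prod_encode (t, m), prod_encode (i, j))"

lemma var_eq_iff [simp]: "var t m i j = var t' m' i' j' \<longleftrightarrow> t = t' \<and> m = m' \<and> i = i' \<and> j = j'"
  by (auto simp: var_def prod_encode_eq)

definition pigeon :: "nat \<Rightarrow> nat \<Rightarrow> nat clause" where
  "pigeon m i = (\<lambda>j. Pos (var 0 m i j)) ` {..<m}"

definition hole :: "nat \<Rightarrow> nat \<Rightarrow> nat \<Rightarrow> nat \<Rightarrow> nat clause" where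
  "hole m i k j = {Neg (var 0 m i j), Neg (var 0 m k j)}"

definition php :: "nat \<Rightarrow> nat cnf" where
  "php m = pigeon m ` {..m} \<union> {hole m i k j | i k j. i \<le> m \<and> k \<le> m \<and> i \<noteq> k \<and> j < m}"

definition php_vars :: "nat \<Rightarrow> nat set" where
  "php_vars m = (\<lambda>(i, j). var 0 m i j) ` ({..m} \<times> {..<m})"

definition php_weak :: "nat \<Rightarrow> nat cnf" where
  "php_weak m = {insert l E | l E. E \<in> php m \<and> var_of l \<in> php_vars m \<and> var_of l \<notin> vars_clause E}"

definition cycle :: "nat \<Rightarrow> nat \<Rightarrow> nat \<Rightarrow> nat cnf" where
  "cycle m i j = (\<lambda>(t, t'). {Neg (var t m i j), Pos (var t' m i j)}) ` {(0, 1), (1, 2), (2, 0)}"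

definition cells :: "nat \<Rightarrow> (nat \<times> nat \<times> nat) set" where
  "cells n = {(m, i, j). m < n \<and> i \<le> m \<and> j < m}"

definition guarded_php :: "nat \<Rightarrow> nat cnf" where
  "guarded_php n = php n \<union> php_weak n \<union> (\<Union>(m, i, j)\<in>cells n. cycle m i j)"

definition all_vars :: "nat \<Rightarrow> nat set" where
  "all_vars n = php_vars n \<union> {var t m i j | t m i j. t < 3 \<and> (m, i, j) \<in> cells n}"

section \<open>Finiteness, well-formedness and variables of the formula\<close>

lemma var_in_php_vars [simp]: "var t m i j \<in> php_vars n \<longleftrightarrow> t = 0 \<and> m = n \<and> i \<le> n \<and> j < n"
  by (auto simp: php_vars_def image_iff)

lemma var_in_all_vars [simp]:
  "var t m i j \<in> all_vars n \<longleftrightarrow> (t = 0 \<and> m = n \<and> i \<le> n \<and> j < n) \<or> (t < 3 \<and> m < n \<and> i \<le> m \<and> j < m)"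
  by (auto simp: all_vars_def cells_def)

lemma finite_php: "finite (php n)"
proof -
  have "{hole n i k j | i k j. i \<le> n \<and> k \<le> n \<and> i \<noteq> k \<and> j < n} \<subseteq>
      (\<lambda>(i, k, j). hole n i k j) ` ({..n} \<times> {..n} \<times> {..<n})"
    by force
  then have "finite {hole n i k j | i k j. i \<le> n \<and> k \<le> n \<and> i \<noteq> k \<and> j < n}"
    by (rule finite_subset) simp
  then show ?thesis by (simp add: php_def)
qed

lemma finite_cells: "finite (cells n)"
proof -
  have "cells n \<subseteq> {..n} \<times> {..n} \<times> {..n}" by (auto simp: cells_def)
  then show ?thesis by (rule finite_subset) simp
qed

lemma card_cells: "card (cells n) \<le> (n + 1) ^ 3"
proof -
  have "cells n \<subseteq> {..n} \<times> {..n} \<times> {..n}" by (auto simp: cells_def)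
  then have "card (cells n) \<le> card ({..n} \<times> {..n} \<times> {..n})" by (intro card_mono) auto
  then show ?thesis by (simp add: card_cartesian_product power3_eq_cube algebra_simps)
qed

lemma is_clause_php: "E \<in> php n \<Longrightarrow> is_clause E"
  by (auto simp: php_def pigeon_def hole_def is_clause_def tautological_def)

lemma php_vars_clause: "E \<in> php n \<Longrightarrow> vars_clause E \<subseteq> php_vars n"
  by (auto simp: php_def pigeon_def hole_def vars_clause_def)

lemma finite_php_weak: "finite (php_weak n)"
proof -
  have "php_weak n \<subseteq> (\<lambda>(l, E). insert l E) ` ((Pos ` php_vars n \<union> Neg ` php_vars n) \<times> php n)"
  proof
    fix C assume "C \<in> php_weak n"
    then obtain l E where "C = insert l E" "E \<in> php n" "var_of l \<in> php_vars n"
      by (auto simp: php_weak_def)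
    then show "C \<in> (\<lambda>(l, E). insert l E) ` ((Pos ` php_vars n \<union> Neg ` php_vars n) \<times> php n)"
      by (cases l) auto
  qed
  then show ?thesis by (rule finite_subset) (simp add: finite_php php_vars_def)
qed

lemma is_cnf_guarded_php: "is_cnf (guarded_php n)"
proof -
  have "is_clause C" if "C \<in> php_weak n" for C
  proof -
    obtain l E where lE: "C = insert l E" "E \<in> php n" "var_of l \<notin> vars_clause E"
      using \<open>C \<in> php_weak n\<close> by (auto simp: php_weak_def)
    have "Pos (var_of l) \<notin> E" "Neg (var_of l) \<notin> E"
      using lE(3) unfolding vars_clause_def by (metis imageI literal.sel)+
    then show ?thesis using is_clause_php[OF lE(2)] lE(1)
      by (cases l) (auto simp: is_clause_def tautological_def)
  qed
  moreover have "is_clause C" if "C \<in> cycle m i j" for C m i j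
    using that by (auto simp: cycle_def is_clause_def tautological_def)
  moreover have "finite (cycle m i j)" for m i j by (simp add: cycle_def)
  ultimately show ?thesis using is_clause_php finite_php finite_php_weak finite_cells
    by (auto simp: is_cnf_def guarded_php_def)
qed

lemma vars_guarded_php: "vars (guarded_php n) = all_vars n"
proof (intro equalityI subsetI)
  fix x assume "x \<in> vars (guarded_php n)"
  then obtain C where C: "C \<in> guarded_php n" "x \<in> vars_clause C" by (auto simp: vars_def)
  then consider "C \<in> php n" | "C \<in> php_weak n" | m i j where "C \<in> cycle m i j" "(m, i, j) \<in> cells n"
    by (auto simp: guarded_php_def)
  then show "x \<in> all_vars n"
  proof cases
    case 1
    then show ?thesis using C php_vars_clause by (auto simp: all_vars_def)
  next
    case 2
    then obtain l E where "C = insert l E" "E \<in> php n" "var_of l \<in> php_vars n"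
      by (auto simp: php_weak_def)
    then show ?thesis using C php_vars_clause by (auto simp: all_vars_def vars_clause_def)
  next
    case 3
    then show ?thesis using C by (auto simp: cycle_def vars_clause_def cells_def)
  qed
next
  fix x assume "x \<in> all_vars n"
  then consider i j where "x = var 0 n i j" "i \<le> n" "j < n"
    | t m i j where "x = var t m i j" "t < 3" "(m, i, j) \<in> cells n"
    by (auto simp: all_vars_def php_vars_def)
  then show "x \<in> vars (guarded_php n)"
  proof cases
    case 1
    then have "pigeon n i \<in> guarded_php n" "x \<in> vars_clause (pigeon n i)"
      by (auto simp: guarded_php_def php_def pigeon_def vars_clause_def image_image)
    then show ?thesis by (auto simp: vars_def)
  next
    case 2
    then have "t = 0 \<or> t = 1 \<or> t = 2" by auto
    then have "\<exists>C\<in>cycle m i j. x \<in> vars_clause C"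
      using 2(1) by (auto simp: cycle_def vars_clause_def)
    then show ?thesis using 2(3) by (force simp: vars_def guarded_php_def)
  qed
qed

text \<open>Level \<open>m\<close> is a pigeonhole principle with pigeons \<open>0..m\<close> and holes \<open>0..m - 1\<close>, and level \<open>n\<close> is
  the original one. In Cook's reduction, pigeon \<open>i\<close> sits in hole \<open>j\<close> at level \<open>m\<close> if it does so at
  level \<open>m + 1\<close>, or if there \<open>i\<close> sits in the last hole \<open>m\<close> and the last pigeon \<open>m + 1\<close> in \<open>j\<close>. The
  first index of \<open>var\<close> is the position in the triple.\<close>

definition positive_sides :: "nat \<Rightarrow> nat \<Rightarrow> nat \<Rightarrow> nat cnf" where
  "positive_sides m i j =
    {{Neg (var 0 (Suc m) i j)}, {Neg (var 0 (Suc m) i m), Neg (var 0 (Suc m) (Suc m) j)}}"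

definition negative_sides :: "nat \<Rightarrow> nat \<Rightarrow> nat \<Rightarrow> nat cnf" where
  "negative_sides m i j =
    {{Pos (var 0 (Suc m) i j), Pos (var 0 (Suc m) i m)},
     {Pos (var 0 (Suc m) i j), Pos (var 0 (Suc m) (Suc m) j)}}"

definition triple :: "nat \<Rightarrow> nat \<Rightarrow> nat \<Rightarrow> nat set" where
  "triple m i j = (\<lambda>t. var t m i j) ` {..<3}"

text \<open>Defines the triple as the function a or (b and c) of the level above: a positive side
  negates one disjunct, the negative sides are the two clauses of its conjunctive normal form. Each
  clause contains all three literals of the triple, so that they form the set for which it is
  blocked.\<close>

definition ext_def :: "nat \<times> nat \<times> nat \<Rightarrow> nat cnf" where
  "ext_def = (\<lambda>(m, i, j). (\<lambda>S. Pos ` triple m i j \<union> S) ` positive_sides m i j \<union>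
     (\<lambda>S. Neg ` triple m i j \<union> S) ` negative_sides m i j)"

section \<open>Set-blockedness of the definitions\<close>

lemma triple_eq: "triple m i j = {var 0 m i j, var 1 m i j, var 2 m i j}"
  by (auto simp: triple_def numeral_3_eq_3 lessThan_Suc numeral_2_eq_2)

text \<open>A positive side is falsified only where the defining function is true, a negative side
  only where it is false. Hence defining clauses of opposite sign never obstruct each other's
  blockedness.\<close>

lemma sides_clash:
  "S \<in> positive_sides m i j \<Longrightarrow> T \<in> negative_sides m i j \<Longrightarrow> tautological (S \<union> T)"
  by (auto simp: positive_sides_def negative_sides_def tautological_def)

lemma compl_image [simp]: "compl ` Pos ` X = Neg ` X" "compl ` Neg ` X = Pos ` X"
  by (simp_all add: image_image)

lemma cycle_meets:
  assumes "D \<in> cycle m i j"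
  shows "D \<inter> Pos ` triple m i j \<noteq> {}" "D \<inter> Neg ` triple m i j \<noteq> {}"
  using assms by (auto simp: cycle_def triple_eq)

lemma ext_def_cases:
  "C \<in> ext_def (m, i, j) \<longleftrightarrow> (\<exists>S\<in>positive_sides m i j. C = Pos ` triple m i j \<union> S) \<or>
     (\<exists>S\<in>negative_sides m i j. C = Neg ` triple m i j \<union> S)"
  by (simp only: ext_def_def prod.case Un_iff image_iff)

lemma set_blocked_union:
  assumes "C = L \<union> S" "L \<noteq> {}" "L \<inter> S = {}" "is_clause C"
    and "\<And>D. D \<in> \<Gamma> \<Longrightarrow> D \<inter> compl ` L \<noteq> {} \<Longrightarrow> D \<inter> L = {} \<Longrightarrow>
      \<exists>T. D = compl ` L \<union> T \<and> compl ` L \<inter> T = {} \<and> tautological (S \<union> T)"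
  shows "set_blocked \<Gamma> C"
proof -
  have "tautological ((C - L) \<union> (D - compl ` L))"
    if D: "D \<in> \<Gamma>" "D \<inter> compl ` L \<noteq> {}" "D \<inter> L = {}" for D
  proof -
    obtain T where T: "D = compl ` L \<union> T" "compl ` L \<inter> T = {}" "tautological (S \<union> T)"
      using assms(5)[OF D] by blast
    have "C - L = S" "D - compl ` L = T" using assms(1,3) T(1,2) by blast+
    then show ?thesis using T(3) by simp
  qed
  then have "set_blocked_for L \<Gamma> C" using assms(1,2) by (auto simp: set_blocked_for_def)
  then show ?thesis using assms(4) by (auto simp: set_blocked_def)
qed

text \<open>Every cycle clause contains literals of both signs of the triple, so setting the triple to
  either constant satisfies it.\<close>

lemma ext_def_set_blocked:
  assumes fresh: "\<And>D. D \<in> \<Gamma> \<Longrightarrow> vars_clause D \<inter> triple m i j \<noteq> {} \<Longrightarrow>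
      D \<in> cycle m i j \<or> D \<in> ext_def (m, i, j)"
    and "C \<in> ext_def (m, i, j)"
  shows "set_blocked \<Gamma> C"
proof -
  let ?X = "triple m i j"
  have disj: "Pos ` ?X \<inter> T = {}" "Neg ` ?X \<inter> T = {}"
    if "T \<in> positive_sides m i j \<or> T \<in> negative_sides m i j" for T
    using that by (auto simp: triple_def positive_sides_def negative_sides_def)
  have ne: "Pos ` ?X \<noteq> {}" "Neg ` ?X \<noteq> {}" by (auto simp: triple_eq)
  have D: "D \<in> ext_def (m, i, j)" if "D \<in> \<Gamma>"
    "(D \<inter> Neg ` ?X \<noteq> {} \<and> D \<inter> Pos ` ?X = {}) \<or> (D \<inter> Pos ` ?X \<noteq> {} \<and> D \<inter> Neg ` ?X = {})" for D
  proof -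
    have "vars_clause D \<inter> ?X \<noteq> {}" using that(2) unfolding vars_clause_def by force
    then show ?thesis using fresh[OF that(1)] cycle_meets[of D m i j] that(2) by blast
  qed
  from assms(2) consider S where "S \<in> positive_sides m i j" "C = Pos ` ?X \<union> S"
    | S where "S \<in> negative_sides m i j" "C = Neg ` ?X \<union> S"
    unfolding ext_def_cases by metis
  then show ?thesis
  proof cases
    case (1 S)
    have "is_clause C"
      using 1 by (auto simp: is_clause_def tautological_def triple_eq positive_sides_def)
    moreover have "\<exists>T. D = compl ` Pos ` ?X \<union> T \<and> compl ` Pos ` ?X \<inter> T = {} \<and> tautological (S \<union> T)"
      if D': "D \<in> \<Gamma>" "D \<inter> compl ` Pos ` ?X \<noteq> {}" "D \<inter> Pos ` ?X = {}" for D
    proof -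
      have "D \<in> ext_def (m, i, j)" using D D' by simp
      moreover have "D \<noteq> Pos ` ?X \<union> T" for T
        using D'(3) ne by (metis Int_Un_distrib2 Int_absorb Un_empty)
      ultimately obtain T where "T \<in> negative_sides m i j" "D = Neg ` ?X \<union> T"
        unfolding ext_def_cases by metis
      then show ?thesis
        using disj(2)[of T] sides_clash[OF 1(1)] by (intro exI[of _ T]) simp
    qed
    ultimately show ?thesis
      by (intro set_blocked_union[OF 1(2) ne(1)] disj(1)) (simp_all add: 1(1))
  next
    case (2 S)
    have "is_clause C"
      using 2 by (auto simp: is_clause_def tautological_def triple_eq negative_sides_def)
    moreover have "\<exists>T. D = compl ` Neg ` ?X \<union> T \<and> compl ` Neg ` ?X \<inter> T = {} \<and> tautological (S \<union> T)"
      if D': "D \<in> \<Gamma>" "D \<inter> compl ` Neg ` ?X \<noteq> {}" "D \<inter> Neg ` ?X = {}" for D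
    proof -
      have "D \<in> ext_def (m, i, j)" using D D' by simp
      moreover have "D \<noteq> Neg ` ?X \<union> T" for T
        using D'(3) ne by (metis Int_Un_distrib2 Int_absorb Un_empty)
      ultimately obtain T where "T \<in> positive_sides m i j" "D = Pos ` ?X \<union> T"
        unfolding ext_def_cases by metis
      then show ?thesis
        using disj(1)[of T] sides_clash[OF _ 2(1), of T] by (intro exI[of _ T]) (simp add: Un_commute)
    qed
    ultimately show ?thesis
      by (intro set_blocked_union[OF 2(2) ne(2)] disj(2)) (simp_all add: 2(1))
  qed
qed

lemma vars_ext_def:
  "C \<in> ext_def (m, i, j) \<Longrightarrow> vars_clause C \<subseteq> triple m i j \<union>
     {var 0 (Suc m) i j, var 0 (Suc m) i m, var 0 (Suc m) (Suc m) j}"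
  by (auto simp: ext_def_def vars_clause_def positive_sides_def negative_sides_def)

lemma card_ext_def: "finite (ext_def c)" "card (ext_def c) \<le> 4"
proof -
  obtain m i j where c: "c = (m, i, j)" by (cases c)
  have "ext_def c = set [Pos ` triple m i j \<union> {Neg (var 0 (Suc m) i j)},
      Pos ` triple m i j \<union> {Neg (var 0 (Suc m) i m), Neg (var 0 (Suc m) (Suc m) j)},
      Neg ` triple m i j \<union> {Pos (var 0 (Suc m) i j), Pos (var 0 (Suc m) i m)},
      Neg ` triple m i j \<union> {Pos (var 0 (Suc m) i j), Pos (var 0 (Suc m) (Suc m) j)}]" (is "_ = set ?xs")
    unfolding c by (simp add: ext_def_def positive_sides_def negative_sides_def insert_commute)
  moreover have "card (set ?xs) \<le> length ?xs" by (rule card_length)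
  ultimately show "finite (ext_def c)" "card (ext_def c) \<le> 4" by simp_all
qed

lemma reach_insert_many:
  assumes "finite S" "\<And>\<Delta> C. \<Gamma> \<subseteq> \<Delta> \<Longrightarrow> \<Delta> \<subseteq> \<Gamma> \<union> S \<Longrightarrow> C \<in> S \<Longrightarrow> rule \<Delta> C"
    "\<And>C. C \<in> S \<Longrightarrow> vars_clause C \<subseteq> V"
  shows "reach rule V (card S) \<Gamma> (\<Gamma> \<union> S)"
proof -
  have "reach rule V (card T) \<Gamma> (\<Gamma> \<union> T)" if "T \<subseteq> S" for T
    using finite_subset[OF that assms(1)] that
  proof (induction T)
    case empty
    then show ?case by (simp add: reach_refl)
  next
    case (insert C T)
    then show ?case using assms(2)[of "\<Gamma> \<union> T" C] assms(3)[of C]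
        reach_step[of rule V "card T" \<Gamma> "\<Gamma> \<union> T" C] by auto
  qed
  then show ?thesis by simp
qed

text \<open>A definition mentions the level above its own, so higher levels must be defined first for the
  triple to be fresh.\<close>

lemma reach_ext_def_cell:
  assumes T: "T \<subseteq> cells n" "\<forall>(m', i', j')\<in>T. m \<le> m'" and c: "(m, i, j) \<in> cells n" "(m, i, j) \<notin> T"
  shows "reach sbc_rule (all_vars n) (card (ext_def (m, i, j)))
    (guarded_php n \<union> \<Union> (ext_def ` T)) (guarded_php n \<union> \<Union> (ext_def ` insert (m, i, j) T))"
proof -
  have "m < n" using c by (simp add: cells_def)
  \<comment> \<open>The clauses of one definition are added one by one, so the current CNF may
    already hold some of \<open>ext_def (m, i, j)\<close>.\<close>
  have fresh: "D \<in> cycle m i j \<or> D \<in> ext_def (m, i, j)"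
    if D: "D \<in> guarded_php n \<union> \<Union> (ext_def ` T) \<union> ext_def (m, i, j)"
      and meets: "vars_clause D \<inter> triple m i j \<noteq> {}" for D
  proof -
    consider "vars_clause D \<subseteq> php_vars n" | m' i' j' where "D \<in> cycle m' i' j'"
      | m' i' j' where "(m', i', j') \<in> T" "D \<in> ext_def (m', i', j')" | "D \<in> ext_def (m, i, j)"
      using D php_vars_clause[of _ n] by (fastforce simp: guarded_php_def php_weak_def vars_clause_def)
    then show ?thesis
    proof cases
      case 1
      then show ?thesis using meets \<open>m < n\<close> by (auto simp: triple_def)
    next
      case 2
      then show ?thesis using meets by (auto simp: triple_def cycle_def vars_clause_def)
    next
      case 3
      then have "m \<le> m'" using T by auto
      \<comment> \<open>Beyond its own triple, a definition at level \<open>m'\<close> mentions only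
        level \<open>Suc m'\<close>, which lies strictly above \<open>m\<close>.\<close>
      then show ?thesis using meets vars_ext_def[OF 3(2)] 3(1) c(2) by (auto simp: triple_def)
    qed simp
  qed
  have "vars_clause C \<subseteq> all_vars n" if "C \<in> ext_def (m, i, j)" for C
  proof -
    have "triple m i j \<union> {var 0 (Suc m) i j, var 0 (Suc m) i m, var 0 (Suc m) (Suc m) j} \<subseteq> all_vars n"
      using c(1) by (auto simp: triple_def cells_def)
    then show ?thesis using vars_ext_def[OF that] by blast
  qed
  moreover have "sbc_rule \<Delta> C"
    if "\<Delta> \<subseteq> guarded_php n \<union> \<Union> (ext_def ` T) \<union> ext_def (m, i, j)" "C \<in> ext_def (m, i, j)" for \<Delta> C
    using ext_def_set_blocked[of \<Delta> m i j C] fresh that unfolding sbc_rule_def by blast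
  ultimately have "reach sbc_rule (all_vars n) (card (ext_def (m, i, j)))
    (guarded_php n \<union> \<Union> (ext_def ` T)) (guarded_php n \<union> \<Union> (ext_def ` T) \<union> ext_def (m, i, j))"
    by (intro reach_insert_many card_ext_def)
  then show ?thesis by (simp add: Un_ac)
qed

lemma reach_ext_def:
  "\<exists>k\<le>4 * card (cells n). reach sbc_rule (all_vars n) k
    (guarded_php n) (guarded_php n \<union> \<Union> (ext_def ` cells n))"
proof -
  define R where "R T \<longleftrightarrow> (\<exists>k\<le>4 * card T. reach sbc_rule (all_vars n) k
    (guarded_php n) (guarded_php n \<union> \<Union> (ext_def ` T)))" for T
  have "T \<subseteq> cells n \<Longrightarrow> R T" if "finite T" for T
    using that
  \<comment> \<open>This induction inserts elements in nondecreasing rank; negating the level makes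
    the highest levels come first.\<close>
  proof (induction T rule: finite_ranking_induct[where f = "\<lambda>c. - int (fst c)"])
    case empty
    have "reach sbc_rule (all_vars n) 0 (guarded_php n) (guarded_php n \<union> \<Union> (ext_def ` {}))"
      by (simp add: reach_refl)
    then show ?case unfolding R_def by blast
  next
    case (insert c T)
    obtain m i j where c: "c = (m, i, j)" by (cases c)
    have above: "\<forall>(m', i', j')\<in>T. m \<le> m'" using insert(2) c by fastforce
    show ?case
    proof (cases "c \<in> T")
      case True
      then show ?thesis using insert by (simp add: insert_absorb)
    next
      case False
      have T: "T \<subseteq> cells n" "(m, i, j) \<in> cells n" "(m, i, j) \<notin> T" using insert(4) c False by auto
      obtain k where k: "k \<le> 4 * card T" "reach sbc_rule (all_vars n) k
        (guarded_php n) (guarded_php n \<union> \<Union> (ext_def ` T))"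
        using insert(3)[OF T(1)] unfolding R_def by metis
      have "k + card (ext_def (m, i, j)) \<le> 4 * card (insert c T)"
        using k(1) False \<open>finite T\<close> card_ext_def(2)[of "(m, i, j)"] by simp
      then show ?thesis
        using reach_trans[OF reach_ext_def_cell[OF T(1) above T(2,3)] k(2)]
        unfolding R_def c by metis
    qed
  qed
  then show ?thesis using finite_cells by (simp add: R_def)
qed

section \<open>Cook's refutation\<close>

lemma is_clause_empty [simp]: "is_clause {}"
  by (simp add: is_clause_def tautological_def)

lemma is_clause_insert [simp]: "is_clause (insert l C) \<longleftrightarrow> is_clause C \<and> compl l \<notin> C"
  by (cases l) (auto simp: is_clause_def tautological_def)

lemma vars_clause_simps [simp]:
  "vars_clause {} = {}" "vars_clause (insert l C) = insert (var_of l) (vars_clause C)"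
  by (simp_all add: vars_clause_def)

lemma notin_vars_clause: "x \<notin> vars_clause C \<Longrightarrow> Pos x \<notin> C" "x \<notin> vars_clause C \<Longrightarrow> Neg x \<notin> C"
  unfolding vars_clause_def by (metis imageI literal.sel)+

text \<open>Two of the implications, y -> z and z -> x, push all positive literals of the triple
  onto \<open>x\<close>. Dually, in the next lemma, x -> y and y -> z pull the negative ones back to
  \<open>x\<close>.\<close>

lemma derives_pos_of_cycle:
  assumes "insert (Pos x) (insert (Pos y) (insert (Pos z) S)) \<in> \<Gamma>"
    and "{Neg y, Pos z} \<in> \<Gamma>" "{Neg z, Pos x} \<in> \<Gamma>"
    and S: "is_clause S" "x \<notin> vars_clause S" "y \<notin> vars_clause S" "z \<notin> vars_clause S"
    and "x \<noteq> y" "y \<noteq> z" "x \<noteq> z" "{x, z} \<union> vars_clause S \<subseteq> V"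
  shows "derives V 2 \<Gamma> {insert (Pos x) S}"
proof -
  note S' = S notin_vars_clause[OF S(2)] notin_vars_clause[OF S(3)] notin_vars_clause[OF S(4)]
  have 1: "derives V 1 \<Gamma> {insert (Pos z) (insert (Pos x) S)}"
    by (rule derives_resolvent[of y "insert (Pos x) (insert (Pos z) S)" _ "{Pos z}"])
      (use assms S' in \<open>auto simp: insert_commute\<close>)
  have 2: "derives V 1 (\<Gamma> \<union> {insert (Pos z) (insert (Pos x) S)}) {insert (Pos x) S}"
    by (rule derives_resolvent[of z "insert (Pos x) S" _ "{Pos x}"]) (use assms S' in auto)
  from derives_cut[OF 1 2] show ?thesis by (rule derives_mono) auto
qed

lemma derives_neg_of_cycle:
  assumes "insert (Neg x) (insert (Neg y) (insert (Neg z) S)) \<in> \<Gamma>"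
    and "{Neg x, Pos y} \<in> \<Gamma>" "{Neg y, Pos z} \<in> \<Gamma>"
    and S: "is_clause S" "x \<notin> vars_clause S" "y \<notin> vars_clause S" "z \<notin> vars_clause S"
    and "x \<noteq> y" "y \<noteq> z" "x \<noteq> z" "{x, y} \<union> vars_clause S \<subseteq> V"
  shows "derives V 2 \<Gamma> {insert (Neg x) S}"
proof -
  note S' = S notin_vars_clause[OF S(2)] notin_vars_clause[OF S(3)] notin_vars_clause[OF S(4)]
  have 1: "derives V 1 \<Gamma> {insert (Neg y) (insert (Neg x) S)}"
    by (rule derives_resolvent[of z "{Neg y}" _ "insert (Neg x) (insert (Neg y) S)"])
      (use assms S' in \<open>auto simp: insert_commute\<close>)
  have 2: "derives V 1 (\<Gamma> \<union> {insert (Neg y) (insert (Neg x) S)}) {insert (Neg x) S}"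
    by (rule derives_resolvent[of y "{Neg x}" _ "insert (Neg x) S"])
      (use assms S' in \<open>auto simp: insert_commute\<close>)
  from derives_cut[OF 1 2] show ?thesis by (rule derives_mono) auto
qed

text \<open>The extension clauses of ordinary extended resolution for \<open>var 0 m i j\<close>.
  From here on the other two members of the triple no longer occur.\<close>

definition narrow_def :: "nat \<Rightarrow> nat \<Rightarrow> nat \<Rightarrow> nat cnf" where
  "narrow_def m i j = insert (Pos (var 0 m i j)) ` positive_sides m i j \<union>
     insert (Neg (var 0 m i j)) ` negative_sides m i j"

lemma derives_narrow_def:
  assumes c: "(m, i, j) \<in> cells n" and \<Gamma>: "ext_def (m, i, j) \<subseteq> \<Gamma>" "cycle m i j \<subseteq> \<Gamma>"
  shows "derives (all_vars n) 8 \<Gamma> (narrow_def m i j)"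
proof -
  have cyc: "{Neg (var 0 m i j), Pos (var 1 m i j)} \<in> \<Gamma>" "{Neg (var 1 m i j), Pos (var 2 m i j)} \<in> \<Gamma>"
    "{Neg (var 2 m i j), Pos (var 0 m i j)} \<in> \<Gamma>"
    using \<Gamma>(2) by (simp_all add: cycle_def)
  have mij: "m < n" "i \<le> m" "j < m" using c by (simp_all add: cells_def)
  have sides: "is_clause S \<and> var 0 m i j \<notin> vars_clause S \<and> var 1 m i j \<notin> vars_clause S \<and>
      var 2 m i j \<notin> vars_clause S \<and> {var 0 m i j, var 1 m i j, var 2 m i j} \<union> vars_clause S \<subseteq> all_vars n"
    if "S \<in> positive_sides m i j \<union> negative_sides m i j" for S
    using that mij by (auto simp: positive_sides_def negative_sides_def)
  have p: "derives (all_vars n) (card (positive_sides m i j) * 2) \<Gamma>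
      (\<Union>S\<in>positive_sides m i j. {insert (Pos (var 0 m i j)) S})"
  proof (rule derives_UN)
    fix S assume S: "S \<in> positive_sides m i j"
    then have "Pos ` triple m i j \<union> S \<in> \<Gamma>" using \<Gamma>(1) ext_def_cases by blast
    then show "derives (all_vars n) 2 \<Gamma> {insert (Pos (var 0 m i j)) S}"
      using cyc sides[of S] S
      by (intro derives_pos_of_cycle[of _ "var 1 m i j" "var 2 m i j"]) (simp_all add: triple_eq)
  qed (simp add: positive_sides_def)
  have q: "derives (all_vars n) (card (negative_sides m i j) * 2) \<Gamma>
      (\<Union>S\<in>negative_sides m i j. {insert (Neg (var 0 m i j)) S})"
  proof (rule derives_UN)
    fix S assume S: "S \<in> negative_sides m i j"
    then have "Neg ` triple m i j \<union> S \<in> \<Gamma>" using \<Gamma>(1) ext_def_cases by blast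
    then show "derives (all_vars n) 2 \<Gamma> {insert (Neg (var 0 m i j)) S}"
      using cyc sides[of S] S
      by (intro derives_neg_of_cycle[of _ "var 1 m i j" "var 2 m i j"]) (simp_all add: triple_eq)
  qed (simp add: negative_sides_def)
  have cards: "card (positive_sides m i j) \<le> 2" "card (negative_sides m i j) \<le> 2"
    unfolding positive_sides_def negative_sides_def by (simp_all add: card_insert_if)
  have "derives (all_vars n) 4 \<Gamma> (insert (Pos (var 0 m i j)) ` positive_sides m i j)"
    using cards by (intro derives_mono[OF p]) auto
  moreover have "derives (all_vars n) 4 (\<Gamma> \<union> insert (Pos (var 0 m i j)) ` positive_sides m i j)
      (insert (Neg (var 0 m i j)) ` negative_sides m i j)"
    using cards by (intro derives_mono[OF q]) auto
  ultimately have "derives (all_vars n) (4 + 4) \<Gamma> (narrow_def m i j)"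
    unfolding narrow_def_def by (rule derives_trans)
  then show ?thesis by simp
qed

text \<open>Here \<open>x\<close>, \<open>y\<close> place two pigeons in hole j at the lower level;
  at the upper level \<open>a\<close>, \<open>d\<close> place them in hole j, \<open>b\<close>,
  \<open>e\<close> in the last hole, and \<open>c\<close> places the last pigeon in hole j. Given
  \<open>x\<close> and \<open>d\<close>, either \<open>a\<close> or \<open>c\<close> shares hole j
  with \<open>d\<close>; so \<open>x\<close> excludes \<open>d\<close>, and likewise
  \<open>y\<close> excludes \<open>a\<close>. Then \<open>x\<close> forces \<open>b\<close> and
  \<open>y\<close> forces \<open>e\<close>, two pigeons in the last hole. The list \<open>C\<close>
  holds the eight resolvents in order.\<close>

lemma derives_hole:
  assumes "{Neg x, Pos a, Pos b} \<in> \<Gamma>" "{Neg x, Pos a, Pos c} \<in> \<Gamma>"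
    and "{Neg y, Pos d, Pos e} \<in> \<Gamma>" "{Neg y, Pos d, Pos c} \<in> \<Gamma>"
    and "{Neg a, Neg d} \<in> \<Gamma>" "{Neg a, Neg c} \<in> \<Gamma>" "{Neg d, Neg c} \<in> \<Gamma>" "{Neg b, Neg e} \<in> \<Gamma>"
    and dist: "distinct [a, b, c, d, e, x, y]" and V: "{a, b, c, d, e, x, y} \<subseteq> V"
  shows "derives V 8 \<Gamma> {{Neg x, Neg y}}"
proof -
  note [simp] = insert_commute
  have dist': "distinct [y, x, e, d, c, b, a]" using dist by auto
  note hyps = assms(1-8) dist dist' V
  define C where "C = [{Neg x, Pos a, Neg d}, {Neg x, Neg d}, {Neg y, Pos d, Neg a}, {Neg y, Neg a},
    {Neg x, Neg y, Pos b}, {Neg x, Neg y, Pos e}, {Neg x, Neg y, Neg e}, {Neg x, Neg y}]"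
  have "derives V k \<Gamma> (set (take k C))" if "k \<le> 8" for k
    using that
  proof (induction k)
    case 0
    then show ?case by (simp add: derives_refl)
  next
    case (Suc k)
    have "k = 0 \<or> k = 1 \<or> k = 2 \<or> k = 3 \<or> k = 4 \<or> k = 5 \<or> k = 6 \<or> k = 7"
      using Suc.prems by linarith
    then have step: "derives V 1 (\<Gamma> \<union> set (take k C)) {C ! k}"
    proof (elim disjE)
      assume "k = 0" then show ?thesis using hyps
        by (intro derives_resolvent[of c "{Neg x, Pos a}" _ "{Neg d}"]) (simp_all add: C_def)
    next
      assume "k = 1" then show ?thesis using hyps
        by (intro derives_resolvent[of a "{Neg x, Neg d}" _ "{Neg d}"]) (simp_all add: C_def)
    next
      assume "k = 2" then show ?thesis using hyps
        by (intro derives_resolvent[of c "{Neg y, Pos d}" _ "{Neg a}"]) (simp_all add: C_def)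
    next
      assume "k = 3" then show ?thesis using hyps
        by (intro derives_resolvent[of d "{Neg y, Neg a}" _ "{Neg a}"])
          (simp_all add: C_def numeral_eq_Suc)
    next
      assume "k = 4" then show ?thesis using hyps
        by (intro derives_resolvent[of a "{Neg x, Pos b}" _ "{Neg y}"])
          (simp_all add: C_def numeral_eq_Suc)
    next
      assume "k = 5" then show ?thesis using hyps
        by (intro derives_resolvent[of d "{Neg y, Pos e}" _ "{Neg x}"])
          (simp_all add: C_def numeral_eq_Suc)
    next
      assume "k = 6" then show ?thesis using hyps
        by (intro derives_resolvent[of b "{Neg x, Neg y}" _ "{Neg e}"])
          (simp_all add: C_def numeral_eq_Suc)
    next
      assume "k = 7" then show ?thesis using hyps
        by (intro derives_resolvent[of e "{Neg x, Neg y}" _ "{Neg x, Neg y}"])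
          (simp_all add: C_def numeral_eq_Suc)
    qed
    have "k < length C" using Suc.prems by (simp add: C_def)
    then show ?case
      using derives_trans[OF Suc.IH step] Suc.prems by (simp add: take_Suc_conv_app_nth)
  qed
  from this[of 8] show ?thesis by (rule derives_mono) (simp_all add: C_def)
qed

lemma hole_in_php: "i \<le> m \<Longrightarrow> k \<le> m \<Longrightarrow> i \<noteq> k \<Longrightarrow> j < m \<Longrightarrow> hole m i k j \<in> php m"
  unfolding php_def by blast

text \<open>Case split on \<open>b\<close>, pigeon i in the last hole. If it is not there, its own
  clause is carried down. If it is, the clause of the last pigeon is carried down, and the literal
  \<open>c\<close> left over contradicts \<open>b\<close> by a hole clause.\<close>

lemma derives_pigeon:
  assumes \<Gamma>: "php (Suc m) \<subseteq> \<Gamma>" "\<And>j. j < m \<Longrightarrow> narrow_def m i j \<subseteq> \<Gamma>" and "m < n" "i \<le> m"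
  shows "derives (all_vars n) (2 * m + 3) \<Gamma> {pigeon m i}"
proof -
  let ?V = "all_vars n"
  define b where "b = var 0 (Suc m) i m"
  define c where "c = var 0 (Suc m) (Suc m) m"
  have bc: "b \<noteq> c" "b \<in> ?V" "c \<in> ?V" using assms by (auto simp: b_def c_def)
  have narrow: "{Neg (var 0 (Suc m) i j), Pos (var 0 m i j)} \<in> \<Gamma>"
    "{Neg (var 0 (Suc m) (Suc m) j), Pos (var 0 m i j), Neg b} \<in> \<Gamma>" if "j < m" for j
    using \<Gamma>(2)[OF that] by (auto simp: narrow_def_def positive_sides_def b_def insert_commute)
  have pig: "pigeon (Suc m) k \<in> \<Gamma>" if "k \<le> Suc m" for k
    using \<Gamma>(1) that by (auto simp: php_def)
  have split: "pigeon (Suc m) k = insert (Pos (var 0 (Suc m) k m)) ((\<lambda>j. Pos (var 0 (Suc m) k j)) ` {..<m})" for k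
    by (simp add: pigeon_def lessThan_Suc)
  have hole: "insert (Neg c) {Neg b} \<in> \<Gamma>"
    using \<Gamma>(1) hole_in_php[of i "Suc m" "Suc m" m] assms(4)
    by (auto simp: hole_def b_def c_def insert_commute)
  have var_pig: "b \<notin> vars_clause (pigeon m i)" "c \<notin> vars_clause (pigeon m i)"
    "vars_clause (pigeon m i) \<subseteq> ?V" "is_clause (pigeon m i)"
    using assms(3,4) by (auto simp: b_def c_def pigeon_def vars_clause_def is_clause_def tautological_def)
  have 1: "derives ?V m \<Gamma> {{Pos b} \<union> pigeon m i}"
    unfolding pigeon_def
    by (rule derives_replace[where f = "\<lambda>j. var 0 (Suc m) i j" and B = "{}"])
      (use narrow(1) pig[of i] split[of i] assms(3,4) bc in
        \<open>auto simp: b_def tautological_def inj_on_def\<close>)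
  \<comment> \<open>The implications for the last pigeon carry the side literal
    \<open>Neg b\<close>; weakening puts it into the start clause, as \<open>derives_replace\<close>
    demands.\<close>
  let ?w = "insert (Neg b) (pigeon (Suc m) (Suc m))"
  have 2: "derives ?V 1 \<Gamma> {?w}"
    by (rule derives_weakening[OF pig[of "Suc m"]])
      (use assms(3,4) bc in \<open>auto simp: pigeon_def vars_clause_def is_clause_def tautological_def b_def\<close>)
  have 3: "derives ?V m (\<Gamma> \<union> {?w}) {{Neg b, Pos c} \<union> pigeon m i}"
    unfolding pigeon_def[of m i]
    by (rule derives_replace[where f = "\<lambda>j. var 0 (Suc m) (Suc m) j" and B = "{Neg b}"])
      (use narrow(2) split[of "Suc m"] assms(3,4) bc in
        \<open>auto simp: b_def c_def tautological_def inj_on_def\<close>)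
  have 4: "derives ?V (1 + m) \<Gamma> {{Neg b, Pos c} \<union> pigeon m i}"
    by (rule derives_cut[OF 2 3])
  have 5: "derives ?V 1 (\<Gamma> \<union> {{Neg b, Pos c} \<union> pigeon m i}) {insert (Neg b) (pigeon m i)}"
    by (rule derives_resolvent[of c "insert (Neg b) (pigeon m i)" _ "{Neg b}"])
      (use hole bc var_pig notin_vars_clause[OF var_pig(1)] in \<open>auto simp: insert_commute\<close>)
  have 6: "derives ?V (1 + m + 1) \<Gamma> {insert (Neg b) (pigeon m i)}"
    by (rule derives_cut[OF 4 5])
  have 7: "derives ?V (m + (1 + m + 1)) \<Gamma> ({{Pos b} \<union> pigeon m i} \<union> {insert (Neg b) (pigeon m i)})"
    by (rule derives_trans[OF 1 derives_mono[OF 6]]) auto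
  have 8: "derives ?V 1 (\<Gamma> \<union> ({{Pos b} \<union> pigeon m i} \<union> {insert (Neg b) (pigeon m i)})) {pigeon m i}"
    by (rule derives_resolvent[of b "pigeon m i" _ "pigeon m i"]) (use var_pig in auto)
  from derives_cut[OF 7 8] show ?thesis by (rule derives_mono) auto
qed

lemma derives_php_hole:
  assumes \<Gamma>: "php (Suc m) \<subseteq> \<Gamma>" "narrow_def m i j \<subseteq> \<Gamma>" "narrow_def m k j \<subseteq> \<Gamma>"
    and "m < n" "i \<le> m" "k \<le> m" "i \<noteq> k" "j < m"
  shows "derives (all_vars n) 8 \<Gamma> {hole m i k j}"
proof -
  have h: "hole (Suc m) p q r \<in> \<Gamma>" if "p \<le> Suc m" "q \<le> Suc m" "p \<noteq> q" "r < Suc m" for p q r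
    using \<Gamma>(1) hole_in_php[OF that] by blast
  note h' = h[unfolded hole_def]
  show ?thesis
    unfolding hole_def
    by (rule derives_hole[of _ "var 0 (Suc m) i j" "var 0 (Suc m) i m" _ "var 0 (Suc m) (Suc m) j" _
          "var 0 (Suc m) k j" "var 0 (Suc m) k m"])
      (use assms(2-) h' in \<open>auto simp: narrow_def_def negative_sides_def\<close>)
qed

text \<open>The factor 11 is 3 + 8: at most n + 1 pigeon clauses at no more than 3 (n + 1) steps
  each, and at most (n + 1)^3 hole clauses at 8 steps each.\<close>

lemma derives_php_level:
  assumes \<Gamma>: "php (Suc m) \<subseteq> \<Gamma>" "\<And>i j. (m, i, j) \<in> cells n \<Longrightarrow> narrow_def m i j \<subseteq> \<Gamma>" and m: "m < n"
  shows "derives (all_vars n) (11 * (n + 1) ^ 3) \<Gamma> (php m)"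
proof -
  let ?I = "{(i, k, j). i \<le> m \<and> k \<le> m \<and> i \<noteq> k \<and> j < m}"
  have narrow: "narrow_def m i j \<subseteq> \<Gamma>" if "i \<le> m" "j < m" for i j
    using \<Gamma>(2)[of i j] that m by (simp add: cells_def)
  have sub: "?I \<subseteq> {..n} \<times> {..n} \<times> {..n}" using m by auto
  then have fin: "finite ?I" by (rule finite_subset) simp
  have "card ?I \<le> card ({..n} \<times> {..n} \<times> {..n})" using sub by (intro card_mono) auto
  then have card: "card ?I \<le> (n + 1) ^ 3"
    by (simp add: card_cartesian_product power3_eq_cube algebra_simps)
  have pig: "derives (all_vars n) (card {..m} * (2 * m + 3)) \<Gamma> (\<Union>i\<in>{..m}. {pigeon m i})"
    using derives_pigeon[OF \<Gamma>(1) narrow m] by (intro derives_UN) auto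
  have "card {..m} * (2 * m + 3) \<le> 3 * (n + 1) ^ 3"
  proof -
    have "card {..m} * (2 * m + 3) \<le> (n + 1) * ((n + 1) * 3)"
      using m by (intro mult_mono) auto
    also have "\<dots> \<le> (n + 1) * ((n + 1) * 3) * (n + 1)" by simp
    also have "\<dots> = 3 * (n + 1) ^ 3" by (simp add: power3_eq_cube algebra_simps)
    finally show ?thesis .
  qed
  from derives_mono[OF pig this] have pig: "derives (all_vars n) (3 * (n + 1) ^ 3) \<Gamma> (pigeon m ` {..m})"
    by (simp add: UNION_singleton_eq_range)
  have "derives (all_vars n) (card ?I * 8) \<Gamma> (\<Union>(i, k, j)\<in>?I. {hole m i k j})"
  proof (rule derives_UN[OF fin])
    fix c assume "c \<in> ?I"
    then obtain i k j where "c = (i, k, j)" "i \<le> m" "k \<le> m" "i \<noteq> k" "j < m" by auto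
    then show "derives (all_vars n) 8 \<Gamma> (case c of (i, k, j) \<Rightarrow> {hole m i k j})"
      using derives_php_hole[OF \<Gamma>(1) narrow narrow m] by simp
  qed
  then have "derives (all_vars n) (8 * (n + 1) ^ 3) (\<Gamma> \<union> pigeon m ` {..m}) (\<Union>(i, k, j)\<in>?I. {hole m i k j})"
    by (rule derives_mono) (use card in auto)
  from derives_trans[OF pig this] show ?thesis
    by (rule derives_mono) (auto simp: php_def)
qed

lemma derives_php_zero:
  assumes \<Gamma>: "php n \<subseteq> \<Gamma>" "\<And>m i j. (m, i, j) \<in> cells n \<Longrightarrow> narrow_def m i j \<subseteq> \<Gamma>"
  shows "derives (all_vars n) (n * (11 * (n + 1) ^ 3)) \<Gamma> (php 0)"
proof -
  have "derives (all_vars n) (k * (11 * (n + 1) ^ 3)) \<Gamma> (php (n - k))" if "k \<le> n" for k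
    using that
  proof (induction k)
    case 0
    then show ?case using \<Gamma>(1) by (simp add: derives_refl)
  next
    case (Suc k)
    have eq: "Suc (n - Suc k) = n - k" using Suc.prems by simp
    have "derives (all_vars n) (11 * (n + 1) ^ 3) (\<Gamma> \<union> php (n - k)) (php (n - Suc k))"
      using \<Gamma>(2) Suc.prems by (intro derives_php_level) (auto simp: eq)
    from derives_cut[OF Suc.IH this] Suc.prems show ?case by (simp add: add.commute)
  qed
  from this[of n] show ?thesis by simp
qed

lemma sbc_rule_is_clause: "sbc_rule \<Gamma> C \<Longrightarrow> is_clause C"
  by (auto simp: sbc_rule_def res_rule_def set_blocked_def is_resolvent_def is_weakening_def)

lemma SBC_minus_proof_guarded_php:
  "\<exists>\<Pi>. SBC_minus_proof (guarded_php n) \<Pi> \<and> length \<Pi> \<le> 24 * (n + 1) ^ 4"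
proof -
  let ?V = "all_vars n" and ?G = "guarded_php n"
  let ?E = "?G \<union> \<Union> (ext_def ` cells n)" and ?N = "\<Union>(m, i, j)\<in>cells n. narrow_def m i j"
  obtain k1 where k1: "k1 \<le> 4 * card (cells n)" "reach sbc_rule ?V k1 ?G ?E"
    using reach_ext_def by blast
  have "derives ?V (card (cells n) * 8) ?E ?N"
  proof (rule derives_UN[OF finite_cells])
    fix c assume c: "c \<in> cells n"
    obtain m i j where mij: "c = (m, i, j)" by (cases c)
    have "ext_def c \<subseteq> ?E" "cycle m i j \<subseteq> ?E"
      using c unfolding guarded_php_def mij by blast+
    then show "derives ?V 8 ?E (case c of (m, i, j) \<Rightarrow> narrow_def m i j)"
      using derives_narrow_def[of m i j n ?E] c unfolding mij by simp
  qed
  moreover have "derives ?V (n * (11 * (n + 1) ^ 3)) (?E \<union> ?N) (php 0)"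
    by (rule derives_php_zero) (auto simp: guarded_php_def)
  ultimately have "derives ?V (card (cells n) * 8 + n * (11 * (n + 1) ^ 3)) ?E (php 0)"
    by (rule derives_cut)
  then obtain k2 \<Delta> where k2: "k2 \<le> card (cells n) * 8 + n * (11 * (n + 1) ^ 3)"
    "reach res_rule ?V k2 ?E \<Delta>" "php 0 \<subseteq> \<Delta>"
    unfolding derives_def by blast
  have "reach sbc_rule ?V (k1 + k2) ?G \<Delta>"
    by (rule reach_trans[OF reach_rule_mono[OF k2(2)] k1(2)]) (simp add: sbc_rule_def)
  \<comment> \<open>Level 0 has one pigeon and no hole, so its pigeon clause is empty.\<close>
  moreover have "{} \<in> \<Delta>" using k2(3) by (auto simp: php_def pigeon_def)
  ultimately obtain \<Pi> where \<Pi>: "is_proof sbc_rule ?G \<Pi>" "\<forall>\<Theta>\<in>set \<Pi>. vars \<Theta> \<subseteq> ?V"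
    "length \<Pi> = Suc (k1 + k2)"
    using reach_imp_is_proof[of sbc_rule ?V "k1 + k2" ?G \<Delta>] sbc_rule_is_clause is_cnf_guarded_php
    by (metis vars_guarded_php order_refl)
  have "SBC_minus_proof ?G \<Pi>"
    using \<Pi> by (simp add: SBC_minus_proof_def SBC_proof_def vars_guarded_php)
  moreover have "length \<Pi> \<le> 24 * (n + 1) ^ 4"
  proof -
    define X Z where "X = (n + 1) ^ 3" and "Z = n * X"
    have Y: "(n + 1) ^ 4 = Z + X" by (simp add: X_def Z_def eval_nat_numeral)
    have "1 \<le> X" "card (cells n) \<le> X" unfolding X_def using card_cells by auto
    \<comment> \<open>Each cell costs 4 steps for its definition and 8 for narrowing it; the last 1
      is the initial CNF in the list.\<close>
    moreover have "length \<Pi> \<le> 12 * card (cells n) + 11 * Z + 1"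
      using \<Pi>(3) k1(1) k2(1) unfolding X_def[symmetric] Z_def by (simp add: mult.left_commute)
    ultimately show ?thesis unfolding Y by (simp add: algebra_simps)
  qed
  ultimately show ?thesis by blast
qed

section \<open>Blocked extensions and critical assignments\<close>

fun holds :: "('v \<Rightarrow> bool) \<Rightarrow> 'v literal \<Rightarrow> bool" where
  "holds \<alpha> (Pos x) = \<alpha> x"
| "holds \<alpha> (Neg x) = (\<not> \<alpha> x)"

definition falsifies :: "('v \<Rightarrow> bool) \<Rightarrow> 'v clause \<Rightarrow> bool" where
  "falsifies \<alpha> C \<longleftrightarrow> (\<forall>l\<in>C. \<not> holds \<alpha> l)"

lemma falsifies_mono: "falsifies \<alpha> B \<Longrightarrow> A \<subseteq> B \<Longrightarrow> falsifies \<alpha> A"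
  by (auto simp: falsifies_def)

lemma not_falsifies_tautological: "tautological C \<Longrightarrow> \<not> falsifies \<alpha> C"
  unfolding tautological_def falsifies_def by (metis holds.simps)

lemma php_unsat: "\<exists>E\<in>php n. falsifies \<alpha> E"
proof (rule ccontr)
  assume none: "\<not> (\<exists>E\<in>php n. falsifies \<alpha> E)"
  have "\<exists>j<n. \<alpha> (var 0 n i j)" if "i \<le> n" for i
  proof -
    have "pigeon n i \<in> php n" using that by (simp add: php_def)
    then have "\<not> falsifies \<alpha> (pigeon n i)" using none by blast
    then show ?thesis by (auto simp: falsifies_def pigeon_def)
  qed
  then obtain f where f: "\<And>i. i \<le> n \<Longrightarrow> f i < n" "\<And>i. i \<le> n \<Longrightarrow> \<alpha> (var 0 n i (f i))" by metis
  have "inj_on f {..n}"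
  proof (rule inj_onI, rule ccontr)
    fix i k assume ik: "i \<in> {..n}" "k \<in> {..n}" "f i = f k" "i \<noteq> k"
    then have "hole n i k (f i) \<in> php n" using f(1)[of i] unfolding php_def by auto
    moreover have "falsifies \<alpha> (hole n i k (f i))"
      using ik f(2)[of i] f(2)[of k] by (simp add: falsifies_def hole_def)
    ultimately show False using none by blast
  qed
  moreover have "f ` {..n} \<subseteq> {..<n}" using f(1) by auto
  ultimately have "card {..n} \<le> card {..<n}" by (intro card_inj_on_le) auto
  then show False by simp
qed

section \<open>Which clauses are blocked with respect to the formula\<close>

lemma not_blocked_for_php_var:
  assumes "is_clause C" "var_of p \<in> php_vars n"
  shows "\<not> blocked_for p (guarded_php n) C"
proof
  assume "blocked_for p (guarded_php n) C"
  then obtain C' where C': "C = {p} \<union> C'" "var_of p \<notin> vars_clause C'"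
    "\<And>D'. {compl p} \<union> D' \<in> guarded_php n \<Longrightarrow> var_of p \<notin> vars_clause D' \<Longrightarrow> tautological (C' \<union> D')"
    unfolding blocked_for_def by blast
  \<comment> \<open>Satisfies \<open>p\<close> and falsifies \<open>C'\<close>. The pigeonhole
    clause \<open>E\<close> that it falsifies therefore avoids \<open>p\<close>, and no literal of
    \<open>E\<close> clashes with \<open>C'\<close>.\<close>
  define \<alpha> where "\<alpha> x = (if x = var_of p then p = Pos x else Neg x \<in> C')" for x
  have "falsifies \<alpha> C'"
    unfolding falsifies_def
  proof
    fix l assume l: "l \<in> C'"
    then have "var_of l \<noteq> var_of p" using C'(2) unfolding vars_clause_def by (metis imageI)
    moreover have "\<not> (Pos x \<in> C' \<and> Neg x \<in> C')" for x
      using assms(1) C'(1) by (auto simp: is_clause_def tautological_def)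
    ultimately show "\<not> holds \<alpha> l" using l by (cases l) (auto simp: \<alpha>_def)
  qed
  have p: "holds \<alpha> p" by (cases p) (simp_all add: \<alpha>_def)
  obtain E where E: "E \<in> php n" "falsifies \<alpha> E" using php_unsat by blast
  have "p \<notin> E" using E(2) p by (auto simp: falsifies_def)
  define D' where "D' = E - {compl p}"
  have "var_of p \<notin> vars_clause D'"
  proof
    assume "var_of p \<in> vars_clause D'"
    then obtain l where "l \<in> E" "l \<noteq> compl p" "var_of l = var_of p"
      unfolding vars_clause_def D'_def by fastforce
    then show False using \<open>p \<notin> E\<close> by (cases l; cases p) auto
  qed
  \<comment> \<open>If \<open>E\<close> lacks \<open>compl p\<close>, its weakening by that literal
    is the clause that refutes blockedness.\<close>
  moreover have "{compl p} \<union> D' \<in> guarded_php n"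
  proof (cases "compl p \<in> E")
    case True
    then have "{compl p} \<union> D' = E" by (auto simp: D'_def)
    then show ?thesis using E by (simp add: guarded_php_def)
  next
    case False
    then have "D' = E" by (simp add: D'_def)
    moreover have "var_of (compl p) = var_of p" by (cases p) auto
    ultimately have "{compl p} \<union> D' \<in> php_weak n"
      using E(1) assms(2) \<open>var_of p \<notin> vars_clause D'\<close> unfolding php_weak_def
      by (intro CollectI exI[of _ "compl p"] exI[of _ E]) simp
    then show ?thesis by (simp add: guarded_php_def)
  qed
  ultimately have "tautological (C' \<union> D')" using C'(3) by blast
  moreover have "falsifies \<alpha> (C' \<union> D')"
    using \<open>falsifies \<alpha> C'\<close> E(2) by (auto simp: falsifies_def D'_def)
  ultimately show False using not_falsifies_tautological by blast
qed

text \<open>The implication is itself one of the clauses against which blockedness is tested, and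
  its single remaining literal can clash only with its own complement in \<open>C\<close>.\<close>

lemma blocked_for_implication:
  assumes "{Neg x, Pos y} \<in> \<Gamma>" "x \<noteq> y" "is_clause C"
  shows "blocked_for (Pos x) \<Gamma> C \<Longrightarrow> Pos x \<in> C \<and> Neg y \<in> C"
    and "blocked_for (Neg y) \<Gamma> C \<Longrightarrow> Pos x \<in> C \<and> Neg y \<in> C"
proof -
  have nt: "\<not> tautological C" using assms(3) by (simp add: is_clause_def)
  show "Pos x \<in> C \<and> Neg y \<in> C" if b: "blocked_for (Pos x) \<Gamma> C"
  proof -
    obtain C' where C': "C = {Pos x} \<union> C'"
      "\<And>D'. {Neg x} \<union> D' \<in> \<Gamma> \<Longrightarrow> x \<notin> vars_clause D' \<Longrightarrow> tautological (C' \<union> D')"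
      using b unfolding blocked_for_def compl.simps literal.sel by blast
    have "tautological (C' \<union> {Pos y})"
      by (rule C'(2)) (use assms in \<open>auto simp: vars_clause_def insert_commute\<close>)
    then show ?thesis using nt C'(1) by (auto simp: tautological_def)
  qed
  show "Pos x \<in> C \<and> Neg y \<in> C" if b: "blocked_for (Neg y) \<Gamma> C"
  proof -
    obtain C' where C': "C = {Neg y} \<union> C'"
      "\<And>D'. {Pos y} \<union> D' \<in> \<Gamma> \<Longrightarrow> y \<notin> vars_clause D' \<Longrightarrow> tautological (C' \<union> D')"
      using b unfolding blocked_for_def compl.simps literal.sel by blast
    have "tautological (C' \<union> {Neg x})"
      by (rule C'(2)) (use assms in \<open>auto simp: vars_clause_def insert_commute\<close>)
    then show ?thesis using nt C'(1) by (auto simp: tautological_def)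
  qed
qed

lemma blocked_guarded_php:
  assumes "is_clause C" "vars_clause C \<subseteq> all_vars n" "blocked (guarded_php n) C"
  obtains t t' m i j where "(t, t') \<in> {(0, 1), (1, 2), (2, 0)}" "m < n"
    "Pos (var t m i j) \<in> C" "Neg (var t' m i j) \<in> C"
proof -
  obtain p where p: "p \<in> C" "blocked_for p (guarded_php n) C"
    using assms(3) by (auto simp: blocked_def)
  have "var_of p \<in> all_vars n" using p(1) assms(2) by (auto simp: vars_clause_def)
  moreover have "var_of p \<notin> php_vars n" using not_blocked_for_php_var[OF assms(1)] p(2) by blast
  ultimately obtain s m i j where s: "var_of p = var s m i j" "s < 3" "(m, i, j) \<in> cells n"
    by (auto simp: all_vars_def)
  have imp: "{Neg (var t m i j), Pos (var t' m i j)} \<in> guarded_php n"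
    if "(t, t') \<in> {(0, 1), (1, 2), (2, 0)}" for t t'
    using that s(3) by (force simp: guarded_php_def cycle_def)
  \<comment> \<open>Each position of the cycle has one outgoing and one incoming implication; the
    outgoing one tests a positive \<open>p\<close>, the incoming one a negative
    \<open>p\<close>.\<close>
  have "\<exists>t'::nat. (s, t') \<in> {(0, 1), (1, 2), (2, 0)}" "\<exists>t::nat. (t, s) \<in> {(0, 1), (1, 2), (2, 0)}"
    using s(2) by (auto simp: less_Suc_eq numeral_eq_Suc)
  then obtain t t' :: nat where t: "(s, t') \<in> {(0, 1), (1, 2), (2, 0)}" "(t, s) \<in> {(0, 1), (1, 2), (2, 0)}"
    by blast
  have ne: "s \<noteq> t'" "t \<noteq> s" using t by auto
  have m: "m < n" using s(3) by (simp add: cells_def)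
  show thesis
  proof (cases p)
    case (Pos x)
    then have "x = var s m i j" using s by simp
    then show thesis
      using blocked_for_implication(1)[OF imp[OF t(1)] _ assms(1)] p(2) Pos ne that[OF t(1) m] by auto
  next
    case (Neg x)
    then have "x = var s m i j" using s by simp
    then show thesis
      using blocked_for_implication(2)[OF imp[OF t(2)] _ assms(1)] p(2) Neg ne that[OF t(2) m] by auto
  qed
qed

lemma guarded_php_not_blocked:
  assumes "C \<in> guarded_php n"
  shows "\<not> blocked (guarded_php n) C"
proof
  assume b: "blocked (guarded_php n) C"
  have "is_clause C" using assms is_cnf_guarded_php by (auto simp: is_cnf_def)
  moreover have "vars_clause C \<subseteq> all_vars n" using assms vars_guarded_php[of n] by (auto simp: vars_def)
  ultimately obtain t t' m i j where t: "(t, t') \<in> {(0, 1), (1, 2), (2, 0)}" "m < n"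
    "Pos (var t m i j) \<in> C" "Neg (var t' m i j) \<in> C"
    using b by (rule blocked_guarded_php)
  consider "vars_clause C \<subseteq> php_vars n" | m' i' j' where "C \<in> cycle m' i' j'"
    using assms php_vars_clause[of _ n] by (fastforce simp: guarded_php_def php_weak_def vars_clause_def)
  then show False
  proof cases
    case 1
    then have "var t m i j \<in> php_vars n" using t(3) by (force simp: vars_clause_def)
    then show False using t(2) by simp
  next
    case 2
    \<comment> \<open>A cycle clause has its negative literal before its positive one; the opposite
      adjacency as well would need a cycle of length two.\<close>
    then show False using t by (auto simp: cycle_def)
  qed
qed

lemma ker_eqI:
  assumes "is_cnf \<Gamma>" "\<And>C. C \<in> \<Gamma> \<Longrightarrow> \<not> blocked \<Gamma> C"
  shows "ker \<Gamma> = \<Gamma>"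
proof -
  have "is_kernel \<Gamma> \<Gamma>" using assms(2) by (auto simp: is_kernel_def)
  then show ?thesis using ex1_is_kernel[OF assms(1)] is_kernel_ker[OF assms(1)] by blast
qed

text \<open>The clause was blocked at the moment of its removal, and later removals only take away
  clauses to test against.\<close>

lemma removed_blocked:
  assumes "remove_blocked\<^sup>*\<^sup>* \<Theta> \<Delta>" "C \<in> \<Theta>" "C \<notin> \<Delta>"
  shows "blocked \<Delta> C"
  using assms
proof (induction rule: rtranclp_induct)
  case (step \<Delta> \<Delta>')
  then obtain D where D: "D \<in> \<Delta>" "blocked \<Delta> D" "\<Delta>' = \<Delta> - {D}" by (auto simp: remove_blocked_def)
  then have "blocked \<Delta> C" using step by (cases "C \<in> \<Delta>") auto
  then show ?case using D(3) by (auto intro: blocked_antimono)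
qed simp

lemma blocked_extension_blocked:
  assumes "is_cnf \<Gamma>" "\<And>C. C \<in> \<Gamma> \<Longrightarrow> \<not> blocked \<Gamma> C" "blocked_extension \<Gamma> \<Lambda>" "C \<in> \<Lambda>" "C \<notin> \<Gamma>"
  shows "blocked \<Gamma> C"
proof -
  have "is_cnf (\<Gamma> \<union> \<Lambda>)" "ker (\<Gamma> \<union> \<Lambda>) = \<Gamma>"
    using assms(1,3) ker_eqI[OF assms(1,2)] by (auto simp: blocked_extension_def is_cnf_def)
  then have "remove_blocked\<^sup>*\<^sup>* (\<Gamma> \<union> \<Lambda>) \<Gamma>" using is_kernel_ker by (force simp: is_kernel_def)
  then show ?thesis using removed_blocked assms(4,5) by blast
qed

text \<open>Only the original variables are constrained by the matching; every extension variable is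
  true, which satisfies all cycle clauses and all new clauses of a blocked extension.\<close>

definition matching_asg :: "nat \<Rightarrow> (nat \<times> nat) set \<Rightarrow> nat \<Rightarrow> bool" where
  "matching_asg n T x \<longleftrightarrow> (\<forall>i j. x = var 0 n i j \<longrightarrow> (i, j) \<in> T)"

lemma matching_asg_var [simp]: "matching_asg n T (var t m i j) \<longleftrightarrow> t \<noteq> 0 \<or> m \<noteq> n \<or> (i, j) \<in> T"
  by (auto simp: matching_asg_def)

text \<open>All holes are filled and only pigeon \<open>i\<close> is left out, so the assignment
  falsifies no original clause but the pigeon clause of \<open>i\<close> and weakenings of
  it.\<close>

definition critical :: "nat \<Rightarrow> nat \<Rightarrow> (nat \<times> nat) set \<Rightarrow> bool" where
  "critical n i T \<longleftrightarrow> i \<le> n \<and> inj_on fst T \<and> inj_on snd T \<and> fst ` T = {..n} - {i} \<and> snd ` T = {..<n}"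

text \<open>The complexity measure of Beame and Pitassi: the least set of pigeons whose pigeon
  clauses imply \<open>C\<close> over the critical assignments that extend \<open>R\<close>.\<close>

definition missing :: "nat \<Rightarrow> (nat \<times> nat) set \<Rightarrow> nat clause \<Rightarrow> nat set" where
  "missing n R C = {i. \<exists>T. critical n i T \<and> R \<subseteq> T \<and> falsifies (matching_asg n T) C}"

definition partial_matching :: "nat \<Rightarrow> (nat \<times> nat) set \<Rightarrow> bool" where
  "partial_matching n R \<longleftrightarrow> R \<subseteq> {..n} \<times> {..<n} \<and> inj_on fst R \<and> inj_on snd R"

definition rows :: "nat \<Rightarrow> (nat \<times> nat) set \<Rightarrow> nat set" where
  "rows n R = {..n} - fst ` R"

definition columns :: "nat \<Rightarrow> (nat \<times> nat) set \<Rightarrow> nat set" where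
  "columns n R = {..<n} - snd ` R"

text \<open>On critical assignments \<open>\<not> (k, j)\<close> means that some other pigeon \<open>i\<close> sits in \<open>j\<close>.\<close>

definition monotone_part :: "nat \<Rightarrow> nat clause \<Rightarrow> (nat \<times> nat) set" where
  "monotone_part n C = {(i, j). Pos (var 0 n i j) \<in> C \<or> (\<exists>k. k \<noteq> i \<and> Neg (var 0 n k j) \<in> C)}"

section \<open>The measure and the monotone part under a restriction\<close>

lemma finite_rows [simp]: "finite (rows n R)" and finite_columns [simp]: "finite (columns n R)"
  by (simp_all add: rows_def columns_def)

lemma card_rows_columns:
  assumes "partial_matching n R"
  shows "finite R" "card (rows n R) = n + 1 - card R" "card (columns n R) = n - card R"
proof -
  show fin: "finite R" using assms finite_subset[of R "{..n} \<times> {..<n}"] by (simp add: partial_matching_def)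
  have "card (fst ` R) = card R" "card (snd ` R) = card R" "fst ` R \<subseteq> {..n}" "snd ` R \<subseteq> {..<n}"
    using assms by (auto simp: partial_matching_def card_image)
  then show "card (rows n R) = n + 1 - card R" "card (columns n R) = n - card R"
    using fin by (simp_all add: rows_def columns_def card_Diff_subset)
qed

lemma missing_subset_rows: "missing n R C \<subseteq> rows n R"
proof
  fix i assume "i \<in> missing n R C"
  then obtain T where "critical n i T" "R \<subseteq> T" by (auto simp: missing_def)
  then have "i \<le> n" "fst ` R \<subseteq> {..n} - {i}" unfolding critical_def by (simp, metis image_mono)
  then show "i \<in> rows n R" by (auto simp: rows_def)
qed

lemma finite_missing [simp]: "finite (missing n R C)"
  by (rule finite_subset[OF missing_subset_rows finite_rows])

text \<open>With \<open>i\<close> left out, equally many pigeons and holes are free, so any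
  bijection between them completes \<open>R\<close> to a critical assignment.\<close>

lemma missing_empty:
  assumes R: "partial_matching n R" and "card R \<le> n"
  shows "missing n R {} = rows n R"
proof (intro equalityI missing_subset_rows subsetI)
  fix i assume i: "i \<in> rows n R"
  have "card (rows n R - {i}) = card (columns n R)"
    using card_rows_columns[OF R] i assms(2) by simp
  then obtain h where h: "bij_betw h (rows n R - {i}) (columns n R)"
    using finite_same_card_bij[of "rows n R - {i}" "columns n R"] by auto
  define G where "G = (\<lambda>a. (a, h a)) ` (rows n R - {i})"
  have fstG: "fst ` G = rows n R - {i}" by (force simp: G_def)
  have sndG: "snd ` G = columns n R" using h by (simp add: G_def image_image bij_betw_def)
  have "inj_on fst G" by (auto simp: G_def inj_on_def)
  moreover have "inj_on snd G" using h by (auto simp: G_def inj_on_def bij_betw_def)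
  ultimately have "inj_on fst (R \<union> G)" "inj_on snd (R \<union> G)"
    using R fstG sndG by (auto simp: inj_on_Un partial_matching_def rows_def columns_def)
  moreover have "fst ` (R \<union> G) = {..n} - {i}" "snd ` (R \<union> G) = {..<n}"
    using R i unfolding image_Un fstG sndG by (auto simp: partial_matching_def rows_def columns_def)
  ultimately have "critical n i (R \<union> G)" using i by (simp add: critical_def rows_def)
  then show "i \<in> missing n R {}" by (auto simp: missing_def falsifies_def)
qed

lemma missing_mono: "A \<subseteq> C \<Longrightarrow> missing n R C \<subseteq> missing n R A"
  unfolding missing_def using falsifies_mono by blast

lemma missing_resolvent:
  assumes "is_resolvent P Q C"
  shows "missing n R C \<subseteq> missing n R P \<union> missing n R Q"
proof -
  obtain x A B where P: "P = A \<union> {Pos x}" "Q = B \<union> {Neg x}" "C = A \<union> B"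
    using assms unfolding is_resolvent_def by blast
  have "falsifies \<alpha> P \<or> falsifies \<alpha> Q" if "falsifies \<alpha> C" for \<alpha>
    using that unfolding P falsifies_def by auto
  then show ?thesis unfolding missing_def by blast
qed

text \<open>Moving pigeon \<open>k\<close>'s hole \<open>j\<close> to the left-out pigeon \<open>i\<close> turns a falsifying assignment into a
  satisfying one, so \<open>C\<close> must notice the change.\<close>

lemma swap_in_monotone_part:
  assumes T: "critical n i T" "R \<subseteq> T" "falsifies (matching_asg n T) C"
    and k: "k \<in> rows n R" "k \<notin> missing n R C"
  obtains j where "(k, j) \<in> T" "j \<in> columns n R" "(i, j) \<in> monotone_part n C"
proof -
  have "i \<in> missing n R C" using T by (auto simp: missing_def)
  then have "k \<noteq> i" using k by auto
  then have "k \<in> fst ` T" using k(1) T(1) by (auto simp: critical_def rows_def)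
  then obtain j where j: "(k, j) \<in> T" by auto
  have inj: "inj_on fst T" "inj_on snd T" using T(1) by (auto simp: critical_def)
  have kR: "(k, j) \<notin> R" using k(1) by (force simp: rows_def)
  have col: "j \<in> columns n R"
  proof -
    have "j \<notin> snd ` R"
    proof
      assume "j \<in> snd ` R"
      then obtain a where "(a, j) \<in> R" by auto
      moreover from this have "(a, j) = (k, j)" using inj_onD[OF inj(2), of "(a, j)" "(k, j)"] j T(2)
        by (simp add: subsetD)
      ultimately show False using kR by simp
    qed
    moreover have "j < n" using T(1) j by (force simp: critical_def)
    ultimately show ?thesis by (simp add: columns_def)
  qed
  define T' where "T' = insert (i, j) (T - {(k, j)})"
  have iT: "i \<notin> fst ` T" "i \<le> n" using T(1) by (auto simp: critical_def)
  have fstT: "fst ` (T - {(k, j)}) = fst ` T - {k}"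
    using j inj_on_image_set_diff[OF inj(1), of T "{(k, j)}"] by simp
  have sndT: "snd ` (T - {(k, j)}) = snd ` T - {j}"
    using j inj_on_image_set_diff[OF inj(2), of T "{(k, j)}"] by simp
  have imT: "fst ` T = {..n} - {i}" "snd ` T = {..<n}" using T(1) by (simp_all add: critical_def)
  have "i \<notin> fst ` (T - {(k, j)})" "j \<notin> snd ` (T - {(k, j)})" using fstT sndT iT by simp_all
  moreover have "inj_on fst (T - {(k, j)})" "inj_on snd (T - {(k, j)})"
    using inj by (simp_all add: inj_on_diff)
  ultimately have "inj_on fst T'" "inj_on snd T'"
    unfolding T'_def inj_on_insert fst_conv snd_conv by blast+
  moreover have "fst ` T' = {..n} - {k}"
    unfolding T'_def image_insert fstT imT(1) using \<open>k \<noteq> i\<close> iT(2) by auto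
  moreover have "snd ` T' = {..<n}"
    unfolding T'_def image_insert sndT imT(2) using col by (auto simp: columns_def)
  ultimately have "critical n k T'" using k(1) by (simp add: critical_def rows_def)
  moreover have "R \<subseteq> T'" using T(2) kR by (auto simp: T'_def)
  ultimately have "\<not> falsifies (matching_asg n T') C" using k(2) by (auto simp: missing_def)
  then obtain l where l: "l \<in> C" "holds (matching_asg n T') l" by (auto simp: falsifies_def)
  have nl: "\<not> holds (matching_asg n T) l" using T(3) l(1) by (auto simp: falsifies_def)
  have "(i, j) \<in> monotone_part n C"
  proof (cases l)
    case (Pos x)
    then obtain a b where ab: "x = var 0 n a b" "(a, b) \<notin> T" "(a, b) \<in> T'"
      using l(2) nl by (auto simp: matching_asg_def)
    then have "(a, b) = (i, j)" by (auto simp: T'_def)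
    then show ?thesis using l(1) Pos ab(1) by (auto simp: monotone_part_def)
  next
    case (Neg x)
    then obtain a b where ab: "x = var 0 n a b" "(a, b) \<in> T" "(a, b) \<notin> T'"
      using l(2) nl by (auto simp: matching_asg_def)
    then have "(a, b) = (k, j)" by (auto simp: T'_def)
    then show ?thesis using l(1) Neg ab(1) \<open>k \<noteq> i\<close> by (auto simp: monotone_part_def)
  qed
  then show thesis using that j col by blast
qed

text \<open>Fix \<open>i\<close> in the measure and one falsifying \<open>T\<close>. Every free
  \<open>k\<close> outside the measure contributes the entry of row \<open>i\<close> in the column
  that \<open>T\<close> gives to \<open>k\<close>, and distinct \<open>k\<close> have distinct
  columns.\<close>

lemma card_monotone_part:
  "card (missing n R C) * (card (rows n R) - card (missing n R C)) \<le>
     card (monotone_part n C \<inter> rows n R \<times> columns n R)"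
proof -
  let ?I = "missing n R C"
  define J where "J i = {j \<in> columns n R. (i, j) \<in> monotone_part n C}" for i
  have J: "card (rows n R) - card ?I \<le> card (J i)" if i: "i \<in> ?I" for i
  proof -
    obtain T where T: "critical n i T" "R \<subseteq> T" "falsifies (matching_asg n T) C"
      using i by (auto simp: missing_def)
    have "\<forall>k\<in>rows n R - ?I. \<exists>j. (k, j) \<in> T \<and> j \<in> J i"
      using swap_in_monotone_part[OF T] unfolding J_def by blast
    then obtain f where f: "\<And>k. k \<in> rows n R - ?I \<Longrightarrow> (k, f k) \<in> T \<and> f k \<in> J i" by metis
    have "inj_on f (rows n R - ?I)"
    proof (rule inj_onI)
      fix k k' assume "k \<in> rows n R - ?I" "k' \<in> rows n R - ?I" "f k = f k'"
      then have "(k, f k) \<in> T" "(k', f k) \<in> T" using f by metis+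
      then show "k = k'" using T(1) inj_onD[of snd T "(k, f k)" "(k', f k)"] by (simp add: critical_def)
    qed
    moreover have "f ` (rows n R - ?I) \<subseteq> J i" using f by blast
    ultimately have "card (rows n R - ?I) \<le> card (J i)" by (intro card_inj_on_le) (auto simp: J_def)
    then show ?thesis by (simp add: card_Diff_subset missing_subset_rows)
  qed
  have "card ?I * (card (rows n R) - card ?I) = (\<Sum>i\<in>?I. card (rows n R) - card ?I)" by simp
  also have "\<dots> \<le> (\<Sum>i\<in>?I. card (J i))" by (rule sum_mono) (rule J)
  also have "\<dots> = card (SIGMA i:?I. J i)" by (subst card_SigmaI) (auto simp: J_def)
  also have "\<dots> \<le> card (monotone_part n C \<inter> rows n R \<times> columns n R)"
    using missing_subset_rows[of n R C] by (intro card_mono) (auto simp: J_def)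
  finally show ?thesis .
qed

text \<open>An entry of the monotone part that lies in \<open>R\<close> makes the clause true under
  every critical assignment extending \<open>R\<close>. So a middle clause is never among those
  discarded by the greedy choice.\<close>

lemma monotone_part_disjoint:
  assumes "missing n R C \<noteq> {}"
  shows "monotone_part n C \<inter> R = {}"
proof (rule ccontr)
  assume "monotone_part n C \<inter> R \<noteq> {}"
  then obtain a b where ab: "(a, b) \<in> R" "(a, b) \<in> monotone_part n C" by auto
  obtain i T where T: "critical n i T" "R \<subseteq> T" "falsifies (matching_asg n T) C"
    using assms by (auto simp: missing_def)
  have abT: "(a, b) \<in> T" using T ab by auto
  from ab(2) consider "Pos (var 0 n a b) \<in> C" | k where "k \<noteq> a" "Neg (var 0 n k b) \<in> C"
    by (auto simp: monotone_part_def)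
  then show False
  proof cases
    case 1
    then show False using T(3) abT by (force simp: falsifies_def)
  next
    case (2 k)
    then have "(k, b) \<in> T" using T(3) by (force simp: falsifies_def)
    then show False using inj_onD[of snd T "(k, b)" "(a, b)"] abT T(1) 2(1) by (simp add: critical_def)
  qed
qed

section \<open>The lower bound\<close>

text \<open>A pigeon clause fails only when its own pigeon is left out, a hole clause never, and
  weakening cannot enlarge the measure. All other clauses have a positive extension literal, which
  \<open>matching_asg\<close> makes true; the second alternative is what
  \<open>blocked_guarded_php\<close> yields for new clauses of an extension.\<close>

lemma guarded_php_missing:
  assumes "C \<in> guarded_php n \<or> (\<exists>t m i j. m < n \<and> Pos (var t m i j) \<in> C)"
  shows "card (missing n R C) \<le> 1"
proof -
  have php: "\<exists>a. missing n R E \<subseteq> {a}" if "E \<in> php n" for E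
  proof -
    from that consider a where "a \<le> n" "E = pigeon n a"
      | i k j where "i \<noteq> k" "E = hole n i k j"
      by (auto simp: php_def)
    then show ?thesis
    proof cases
      case (1 a)
      have "i = a" if T: "critical n i T" "falsifies (matching_asg n T) E" for i T
      proof (rule ccontr)
        assume "i \<noteq> a"
        then have "a \<in> fst ` T" using T(1) 1(1) by (simp add: critical_def)
        then obtain j where j: "(a, j) \<in> T" by auto
        then have "j \<in> snd ` T" by force
        then have "j < n" using T(1) by (simp add: critical_def)
        then show False using T(2) j by (auto simp: 1(2) falsifies_def pigeon_def)
      qed
      then show ?thesis by (auto simp: missing_def)
    next
      case (2 i k j)
      have False if T: "critical n a T" "falsifies (matching_asg n T) E" for a T
      proof -
        have "(i, j) \<in> T" "(k, j) \<in> T" using T(2) by (auto simp: 2(2) falsifies_def hole_def)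
        then show False using T(1) 2(1) inj_onD[of snd T "(i, j)" "(k, j)"] by (simp add: critical_def)
      qed
      then show ?thesis by (auto simp: missing_def)
    qed
  qed
  have true: "\<exists>a. missing n R C \<subseteq> {a}" if "m < n" "Pos (var t m i j) \<in> C" for t m i j
  proof -
    have "\<not> falsifies (matching_asg n T) C" for T
      using that by (force simp: falsifies_def)
    then show ?thesis by (simp add: missing_def)
  qed
  from assms consider "C \<in> php n" | l E where "C = insert l E" "E \<in> php n"
    | m i j where "C \<in> cycle m i j" "m < n" | t m i j where "m < n" "Pos (var t m i j) \<in> C"
    by (auto simp: guarded_php_def php_weak_def cells_def)
  then have "\<exists>a. missing n R C \<subseteq> {a}"
  proof cases
    case 1
    then show ?thesis by (rule php)
  next
    case (2 l E)
    then have "missing n R C \<subseteq> missing n R E" by (intro missing_mono) auto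
    then show ?thesis using php[OF 2(2)] by blast
  next
    case (3 m i j)
    then obtain t where "Pos (var t m i j) \<in> C" by (auto simp: cycle_def)
    then show ?thesis using true 3(2) by blast
  next
    case 4
    then show ?thesis by (rule true)
  qed
  then obtain a where "missing n R C \<subseteq> {a}" by blast
  then show ?thesis using card_mono[of "{a}" "missing n R C"] by simp
qed

lemma is_proof_nth_mono:
  assumes "is_proof rule \<Gamma> \<Pi>" "i \<le> j" "j < length \<Pi>"
  shows "\<Pi> ! i \<subseteq> \<Pi> ! j"
  using assms(2,3)
proof (induction j rule: dec_induct)
  case (step j)
  then have "\<Pi> ! Suc j = \<Pi> ! j \<union> {SOME C. \<Pi> ! Suc j = \<Pi> ! j \<union> {C}}"
    using assms(1) unfolding is_proof_def by (metis (mono_tags, lifting) someI)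
  then have "\<Pi> ! j \<subseteq> \<Pi> ! Suc j" by blast
  then show ?case using step by simp
qed simp

text \<open>Initial clauses are free of charge in the length of a proof, so the counting has to be
  confined to clauses outside the initial CNF.\<close>

lemma is_proof_card_new:
  assumes "is_proof rule \<Gamma> \<Pi>" "i < length \<Pi>"
  shows "finite (\<Pi> ! i - \<Gamma>) \<and> card (\<Pi> ! i - \<Gamma>) \<le> i"
  using assms(2)
proof (induction i)
  case 0
  then show ?case using assms(1) by (simp add: is_proof_def hd_conv_nth)
next
  case (Suc i)
  then obtain C where "\<Pi> ! Suc i = \<Pi> ! i \<union> {C}" using assms(1) unfolding is_proof_def by blast
  then have sub: "\<Pi> ! Suc i - \<Gamma> \<subseteq> insert C (\<Pi> ! i - \<Gamma>)" by blast
  have fin: "finite (insert C (\<Pi> ! i - \<Gamma>))" using Suc by simp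
  have "card (\<Pi> ! Suc i - \<Gamma>) \<le> Suc (card (\<Pi> ! i - \<Gamma>))"
    using card_mono[OF fin sub] card_insert_le_m1[of "Suc (card (\<Pi> ! i - \<Gamma>))" "\<Pi> ! i - \<Gamma>" C] by simp
  then show ?case using Suc finite_subset[OF sub fin] by simp
qed

text \<open>The size of \<open>missing\<close> is subadditive under resolution, at most 1 on axioms and maximal on the
  empty clause, so it cannot jump over the middle third.\<close>

lemma exists_middle_clause:
  assumes \<Pi>: "resolution_proof \<Gamma> \<Pi>" and R: "partial_matching n R" "card R + 3 \<le> n"
    and init: "\<And>C. C \<in> \<Gamma> \<Longrightarrow> card (missing n R C) \<le> 1"
  shows "\<exists>C\<in>last \<Pi> - \<Gamma>. card (rows n R) \<le> 3 * card (missing n R C) \<and>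
    3 * card (missing n R C) \<le> 2 * card (rows n R)"
proof (rule ccontr)
  assume none: "\<not> ?thesis"
  let ?p = "card (rows n R)" and ?c = "\<lambda>C. card (missing n R C)"
  \<comment> \<open>With at least four free rows, the measure 1 of an axiom is below a third of
    them.\<close>
  have p: "4 \<le> ?p" using card_rows_columns(2)[OF R(1)] R(2) by simp
  have proof': "is_proof res_rule \<Gamma> \<Pi>" using \<Pi> by (simp add: resolution_proof_def)
  then have ne: "\<Pi> \<noteq> []" "hd \<Pi> = \<Gamma>" "{} \<in> last \<Pi>" by (simp_all add: is_proof_def)
  have last: "last \<Pi> = \<Pi> ! (length \<Pi> - 1)" using ne(1) by (rule last_conv_nth)
  have "\<forall>C\<in>\<Pi> ! i. 3 * ?c C < ?p" if "i < length \<Pi>" for i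
    using that
  proof (induction i)
    case 0
    have "3 * ?c C < ?p" if "C \<in> \<Gamma>" for C using init[OF that] p by linarith
    then show ?case using ne by (simp add: hd_conv_nth)
  next
    case (Suc i)
    obtain C where C: "res_rule (\<Pi> ! i) C" "\<Pi> ! Suc i = \<Pi> ! i \<union> {C}"
      using proof' Suc.prems unfolding is_proof_def by blast
    have IH: "3 * ?c D < ?p" if "D \<in> \<Pi> ! i" for D using Suc that by simp
    have "3 * ?c C < ?p"
    proof (cases "C \<in> \<Gamma>")
      case True
      then show ?thesis using init[OF True] p by linarith
    next
      case False
      have "3 * ?c C \<le> 2 * ?p"
      proof -
        from C(1) consider P Q where "P \<in> \<Pi> ! i" "Q \<in> \<Pi> ! i" "is_resolvent P Q C"
          | A where "A \<in> \<Pi> ! i" "A \<subseteq> C"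
          unfolding res_rule_def is_weakening_def by blast
        then show ?thesis
        proof cases
          case (1 P Q)
          have "?c C \<le> card (missing n R P \<union> missing n R Q)"
            using missing_resolvent[OF 1(3)] by (intro card_mono) auto
          also have "\<dots> \<le> ?c P + ?c Q" by (rule card_Un_le)
          finally show ?thesis using IH[OF 1(1)] IH[OF 1(2)] by linarith
        next
          case (2 A)
          have "?c C \<le> ?c A" using missing_mono[OF 2(2)] by (intro card_mono) auto
          then show ?thesis using IH[OF 2(1)] by linarith
        qed
      qed
      moreover have "C \<in> last \<Pi>"
        using is_proof_nth_mono[OF proof', of "Suc i" "length \<Pi> - 1"] Suc.prems C(2) last by auto
      ultimately show ?thesis using none False by (meson DiffI not_le)
    qed
    then show ?case using IH C(2) by blast
  qed
  from this[of "length \<Pi> - 1"] have "3 * ?c {} < ?p" using ne last by simp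
  moreover have "missing n R {} = rows n R" using missing_empty[OF R(1)] R(2) by simp
  ultimately show False by simp
qed

text \<open>Clauses of \<open>N\<close> not yet made true by \<open>R\<close> and still wide on the
  free grid. Cutting down to the grid matters: a negative literal puts almost a whole unbounded
  column into \<open>monotone_part\<close>.\<close>

definition surviving :: "nat \<Rightarrow> nat cnf \<Rightarrow> (nat \<times> nat) set \<Rightarrow> nat cnf" where
  "surviving n N R = {C \<in> N. monotone_part n C \<inter> R = {} \<and>
     n * n \<le> 18 * card (monotone_part n C \<inter> rows n R \<times> columns n R)}"

text \<open>At most \<open>(n + 1) n \<le> 2 n\<^sup>2\<close> entries remain, and a surviving clause contains at least \<open>n\<^sup>2 / 18\<close>
  of them, so by averaging some entry hits a 36th of the surviving clauses.\<close>

lemma exists_popular_entry: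
  assumes N: "finite N" and R: "partial_matching n R" "card R < n"
  shows "\<exists>e\<in>rows n R \<times> columns n R.
    card (surviving n N R) \<le> 36 * card {C \<in> surviving n N R. e \<in> monotone_part n C}"
proof (rule ccontr)
  let ?G = "rows n R \<times> columns n R" and ?A = "surviving n N R"
  let ?hits = "\<lambda>e. {C \<in> ?A. e \<in> monotone_part n C}"
  assume "\<not> ?thesis"
  then have few: "36 * card (?hits e) < card ?A" if "e \<in> ?G" for e using that by (meson not_le)
  have finA: "finite ?A" using N by (simp add: surviving_def)
  have cardG: "card ?G = (n + 1 - card R) * (n - card R)"
    using card_rows_columns[OF R(1)] by (simp add: card_cartesian_product)
  then have "0 < card ?G" using R(2) by simp
  then have finG: "finite ?G" "?G \<noteq> {}" by (auto simp: card_gt_0_iff)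
  have "card ?G \<le> (n + n) * n" unfolding cardG using R(2) by (intro mult_mono) auto
  then have G2: "card ?G \<le> 2 * (n * n)" by (simp only: mult_2 distrib_right)
  have swap: "(\<Sum>e\<in>?G. card (?hits e)) = (\<Sum>C\<in>?A. card (monotone_part n C \<inter> ?G))"
  proof -
    have "(\<Sum>e\<in>?G. card (?hits e)) = (\<Sum>e\<in>?G. \<Sum>C\<in>?A. if e \<in> monotone_part n C then 1 else 0)"
      using finA by (simp add: sum.If_cases Int_def)
    also have "\<dots> = (\<Sum>C\<in>?A. \<Sum>e\<in>?G. if e \<in> monotone_part n C then 1 else 0)" by (rule sum.swap)
    also have "\<dots> = (\<Sum>C\<in>?A. card (monotone_part n C \<inter> ?G))"
      using finG by (simp add: sum.If_cases Int_commute)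
    finally show ?thesis .
  qed
  have "card ?A * (n * n) = (\<Sum>C\<in>?A. n * n)" by simp
  also have "\<dots> \<le> (\<Sum>C\<in>?A. 18 * card (monotone_part n C \<inter> ?G))"
    by (rule sum_mono) (simp add: surviving_def)
  also have "\<dots> = 18 * (\<Sum>e\<in>?G. card (?hits e))" by (simp add: swap sum_distrib_left)
  finally have "2 * (card ?A * (n * n)) \<le> (\<Sum>e\<in>?G. 36 * card (?hits e))"
    by (simp add: sum_distrib_left[symmetric] algebra_simps)
  also have "\<dots> < (\<Sum>e\<in>?G. card ?A)" using finG few by (intro sum_strict_mono) auto
  also have "\<dots> = card ?G * card ?A" by simp
  also have "\<dots> \<le> 2 * (n * n) * card ?A" using G2 by (rule mult_right_mono) simp
  finally show False by (simp add: mult.commute mult.left_commute)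
qed

text \<open>A popular entry lies in a free row and column, so it extends the matching. The clauses
  it hits drop out, at least a 36th of the survivors, and no clause comes back because the free grid
  only shrinks.\<close>

lemma greedy_restriction:
  assumes N: "finite N" and "s \<le> n"
  shows "\<exists>R. partial_matching n R \<and> card R = s \<and> 36 ^ s * card (surviving n N R) \<le> 35 ^ s * card N"
  using assms(2)
proof (induction s)
  case 0
  have "card (surviving n N {}) \<le> card N" using N by (intro card_mono) (auto simp: surviving_def)
  then show ?case by (intro exI[of _ "{}"]) (simp add: partial_matching_def)
next
  case (Suc s)
  then obtain R where R: "partial_matching n R" "card R = s"
    "36 ^ s * card (surviving n N R) \<le> 35 ^ s * card N"
    by auto
  let ?A = "surviving n N R"
  obtain i j where e: "i \<in> rows n R" "j \<in> columns n R"
    "card ?A \<le> 36 * card {C \<in> ?A. (i, j) \<in> monotone_part n C}"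
    using exists_popular_entry[OF N R(1)] R(2) Suc.prems by auto
  let ?H = "{C \<in> ?A. (i, j) \<in> monotone_part n C}" and ?R = "insert (i, j) R"
  have finA: "finite ?A" using N by (simp add: surviving_def)
  have new: "i \<notin> fst ` R" "j \<notin> snd ` R" "i \<le> n" "j < n" using e(1,2) by (auto simp: rows_def columns_def)
  then have "(i, j) \<notin> R" by force
  have "fst ` (R - {(i, j)}) \<subseteq> fst ` R" "snd ` (R - {(i, j)}) \<subseteq> snd ` R" by auto
  then have "partial_matching n ?R"
    using R(1) new unfolding partial_matching_def inj_on_insert by auto
  moreover have "card ?R = Suc s" using \<open>(i, j) \<notin> R\<close> card_rows_columns(1)[OF R(1)] R(2) by simp
  moreover have "36 ^ Suc s * card (surviving n N ?R) \<le> 35 ^ Suc s * card N"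
  proof -
    have "surviving n N ?R \<subseteq> ?A - ?H"
    proof
      fix C assume C: "C \<in> surviving n N ?R"
      have "card (monotone_part n C \<inter> rows n ?R \<times> columns n ?R) \<le>
          card (monotone_part n C \<inter> rows n R \<times> columns n R)"
        by (intro card_mono) (auto simp: rows_def columns_def)
      then show "C \<in> ?A - ?H" using C unfolding surviving_def by auto
    qed
    then have "card (surviving n N ?R) \<le> card (?A - ?H)" using finA by (intro card_mono) auto
    also have "\<dots> = card ?A - card ?H" using finA by (intro card_Diff_subset) auto
    finally have "36 * card (surviving n N ?R) \<le> 35 * card ?A" using e(3) by linarith
    then have "36 ^ s * (36 * card (surviving n N ?R)) \<le> 36 ^ s * (35 * card ?A)" by simp
    also have "\<dots> \<le> 35 * (35 ^ s * card N)" using R(3) by simp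
    finally show ?thesis by (simp add: mult.assoc mult.left_commute)
  qed
  ultimately show ?case by blast
qed

text \<open>After n div 2 greedy choices a middle clause still exists and is a survivor, so the
  bound on the number of survivors is at least 1. From n = 6 on, these choices leave the three spare
  holes that \<open>exists_middle_clause\<close> asks for.\<close>

lemma resolution_size:
  assumes \<Pi>: "resolution_proof \<Gamma> \<Pi>" and n: "6 \<le> n"
    and init: "\<And>C R. C \<in> \<Gamma> \<Longrightarrow> card (missing n R C) \<le> 1"
  shows "36 ^ (n div 2) \<le> 35 ^ (n div 2) * length \<Pi>"
proof -
  let ?N = "last \<Pi> - \<Gamma>"
  have pr: "is_proof res_rule \<Gamma> \<Pi>" using \<Pi> by (simp add: resolution_proof_def)
  then have "\<Pi> \<noteq> []" by (simp add: is_proof_def)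
  then have N: "finite ?N" "card ?N \<le> length \<Pi>"
    using is_proof_card_new[OF pr, of "length \<Pi> - 1"]
    by (auto simp: last_conv_nth intro: le_trans)
  obtain R where R: "partial_matching n R" "card R = n div 2"
    "36 ^ (n div 2) * card (surviving n ?N R) \<le> 35 ^ (n div 2) * card ?N"
    using greedy_restriction[OF N(1), of "n div 2" n] by auto
  define p where "p = card (rows n R)"
  have p: "n \<le> 2 * p" using card_rows_columns(2)[OF R(1)] R(2) by (simp add: p_def)
  have half: "card R + 3 \<le> n" using R(2) n by linarith
  obtain C where C: "C \<in> ?N" "p \<le> 3 * card (missing n R C)" "3 * card (missing n R C) \<le> 2 * p"
    using exists_middle_clause[OF \<Pi> R(1) half init] unfolding p_def by blast
  define c where "c = card (missing n R C)"
  have "2 * (p * p) \<le> 9 * (c * (p - c))"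
  proof -
    \<comment> \<open>Both factors are nonnegative for a middle clause, and their product is 9 c (p
      - c) - 2 p^2; integers avoid truncated subtraction.\<close>
    have "(0::int) \<le> (3 * int c - int p) * (2 * int p - 3 * int c)"
      using C(2,3) by (intro mult_nonneg_nonneg) (simp_all add: c_def)
    then have "2 * (int p * int p) \<le> 9 * (int c * (int p - int c))" by (simp add: algebra_simps)
    moreover have "int (p - c) = int p - int c" using C(3) by (simp add: c_def of_nat_diff)
    ultimately have "int (2 * (p * p)) \<le> int (9 * (c * (p - c)))" by simp
    then show ?thesis by (simp only: of_nat_le_iff)
  qed
  moreover have "n * n \<le> 2 * p * (2 * p)" using p by (intro mult_mono) auto
  moreover have "c * (p - c) \<le> card (monotone_part n C \<inter> rows n R \<times> columns n R)"
    unfolding c_def p_def by (rule card_monotone_part)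
  ultimately have "n * n \<le> 18 * card (monotone_part n C \<inter> rows n R \<times> columns n R)" by simp
  moreover have "monotone_part n C \<inter> R = {}"
    using C(2) p n by (intro monotone_part_disjoint) auto
  ultimately have "C \<in> surviving n ?N R" using C(1) by (simp add: surviving_def)
  moreover have "finite (surviving n ?N R)"
    using N(1) by (rule rev_finite_subset) (auto simp: surviving_def)
  ultimately have "1 \<le> card (surviving n ?N R)" by (auto simp: Suc_le_eq card_gt_0_iff)
  then have "36 ^ (n div 2) * 1 \<le> 36 ^ (n div 2) * card (surviving n ?N R)" by (rule mult_left_mono) simp
  also have "\<dots> \<le> 35 ^ (n div 2) * length \<Pi>"
    by (rule order_trans[OF R(3)]) (use N(2) in simp)
  finally show ?thesis by simp
qed

text \<open>Only \<open>\<Lambda>\<close> is confined to the variables of the formula. Clauses of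
  \<open>\<Pi>\<close> may contain others, but \<open>matching_asg\<close> is total, so the counting
  covers them too.\<close>

lemma GER_minus_size:
  assumes "GER_minus_proof (guarded_php n) P" "6 \<le> n"
  shows "36 ^ (n div 2) \<le> 35 ^ (n div 2) * GER_size P"
proof -
  obtain \<Lambda> \<Pi> where P: "P = (\<Lambda>, \<Pi>)" by (cases P)
  let ?G = "guarded_php n"
  have ext: "blocked_extension ?G \<Lambda>" and \<Pi>: "resolution_proof (?G \<union> \<Lambda>) \<Pi>" and vars: "vars \<Lambda> \<subseteq> all_vars n"
    using assms(1) by (simp_all add: P GER_minus_proof_def GER_proof_def vars_guarded_php)
  have "card (missing n R C) \<le> 1" if "C \<in> ?G \<union> \<Lambda>" for C R
  proof (rule guarded_php_missing)
    show "C \<in> ?G \<or> (\<exists>t m i j. m < n \<and> Pos (var t m i j) \<in> C)"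
    proof (cases "C \<in> ?G")
      case False
      then have C: "C \<in> \<Lambda>" using that by simp
      then have "is_clause C" "vars_clause C \<subseteq> all_vars n"
        using ext vars by (auto simp: blocked_extension_def is_cnf_def vars_def)
      moreover have "blocked ?G C"
        by (rule blocked_extension_blocked[OF is_cnf_guarded_php guarded_php_not_blocked ext C False])
      ultimately show ?thesis by (rule blocked_guarded_php) blast
    qed simp
  qed
  from resolution_size[OF \<Pi> assms(2) this]
  have "36 ^ (n div 2) \<le> 35 ^ (n div 2) * length \<Pi>" by simp
  also have "\<dots> \<le> 35 ^ (n div 2) * GER_size P" by (simp add: P GER_size_def)
  finally show ?thesis .
qed

section \<open>Passage to powers of two\<close>

lemma two_powr_le: "2 powr (1 / 36) \<le> (36 / 35 :: real)"
proof -
  define x :: real where "x = 36 / 35"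
  have x: "0 < x" by (simp add: x_def)
  have "1 + real 36 * (1 / 35) \<le> (1 + 1 / 35) ^ 36" by (rule Bernoulli_inequality) simp
  moreover have "1 + 1 / 35 = x" by (simp add: x_def)
  ultimately have "2 \<le> x ^ 36" by simp
  then have "2 powr (1 / 36) \<le> (x ^ 36) powr (1 / 36)" by (intro powr_mono2) auto
  also have "x ^ 36 = x powr 36" using x by simp
  also have "(x powr 36) powr (1 / 36) = x powr (36 * (1 / 36))" by (rule powr_powr)
  also have "\<dots> = x" using x by simp
  finally show ?thesis by (simp only: x_def)
qed

lemma two_powr_le_GER_size:
  assumes "GER_minus_proof (guarded_php n) P" "6 \<le> n"
  shows "2 powr (1 / 144 * real n) \<le> real (GER_size P)"
proof -
  let ?r = "n div 2"
  \<comment> \<open>Bounding n div 2 by n / 4 absorbs the rounding; 1 / 144 is 1 / 36 times this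
    quarter.\<close>
  have "real n / 4 \<le> real ?r" using assms(2) by linarith
  then have "2 powr (1 / 144 * real n) \<le> 2 powr (1 / 36 * real ?r)" by (intro powr_mono) auto
  also have "\<dots> = (2 powr (1 / 36)) powr real ?r" by (rule powr_powr[symmetric])
  also have "\<dots> = (2 powr (1 / 36)) ^ ?r" by (rule powr_realpow) simp
  also have "\<dots> \<le> (36 / 35) ^ ?r" by (intro power_mono two_powr_le) simp
  also have "\<dots> \<le> real (GER_size P)"
  proof -
    have "real (36 ^ ?r) \<le> real (35 ^ ?r * GER_size P)"
      using GER_minus_size[OF assms] by (simp only: of_nat_le_iff)
    then show ?thesis by (simp add: power_divide divide_le_eq mult.commute)
  qed
  finally show ?thesis .
qed

theorem theorem1p5:
  "\<exists>\<Gamma> :: nat \<Rightarrow> nat cnf.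
     (\<forall>n\<ge>1. is_cnf (\<Gamma> n)) \<and>
     (\<exists>(k :: nat) (s :: nat \<Rightarrow> nat). (\<lambda>n. real (s n)) \<in> O(\<lambda>n. real n ^ k) \<and>
        (\<forall>n\<ge>1. \<exists>\<Pi>. SBC_minus_proof (\<Gamma> n) \<Pi> \<and> length \<Pi> \<le> s n)) \<and>
     (\<exists>\<epsilon> > (0 :: real). eventually (\<lambda>n.
        \<forall>P. GER_minus_proof (\<Gamma> n) P \<longrightarrow> 2 powr (\<epsilon> * real n) \<le> real (GER_size P)) sequentially)"
proof (intro exI[of _ guarded_php] conjI)
  show "\<forall>n\<ge>1. is_cnf (guarded_php n)" using is_cnf_guarded_php by blast
  have "(\<lambda>n. real (24 * (n + 1) ^ 4)) \<in> O(\<lambda>n. real n ^ 4)"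
  \<comment> \<open>384 is 24 * 2^4, from n + 1 <= 2 n.\<close>
  proof (rule bigoI[of _ 384])
    have "24 * real (n + 1) ^ 4 \<le> 384 * real n ^ 4" if "1 \<le> n" for n
    proof -
      have "real (n + 1) ^ 4 \<le> (2 * real n) ^ 4" using that by (intro power_mono) auto
      then show ?thesis by (simp add: power_mult_distrib)
    qed
    then show "\<forall>\<^sub>F n in sequentially. norm (real (24 * (n + 1) ^ 4)) \<le> 384 * norm (real n ^ 4)"
      by (intro eventually_sequentiallyI[of 1]) simp
  qed
  then show "\<exists>(k :: nat) (s :: nat \<Rightarrow> nat). (\<lambda>n. real (s n)) \<in> O(\<lambda>n. real n ^ k) \<and>
      (\<forall>n\<ge>1. \<exists>\<Pi>. SBC_minus_proof (guarded_php n) \<Pi> \<and> length \<Pi> \<le> s n)"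
    using SBC_minus_proof_guarded_php
    by (intro exI[of _ "4 :: nat"] exI[of _ "\<lambda>n. 24 * (n + 1) ^ 4"] conjI allI impI)
  show "\<exists>\<epsilon> > (0 :: real). eventually (\<lambda>n. \<forall>P. GER_minus_proof (guarded_php n) P \<longrightarrow>
      2 powr (\<epsilon> * real n) \<le> real (GER_size P)) sequentially"
    using two_powr_le_GER_size by (intro exI[of _ "1 / 144"] conjI eventually_sequentiallyI[of 6]) auto
qed

end
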